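(* Let $\mathrm{d}=(d_1,\dots,d_n)$ be any degree sequence, let $\mathrm{T}$ be a uniformly random element of $\mathcal{T}_{\mathrm{d}}$, and write $\delta=(n-n_1(\mathrm{d}))/n$. Then for all $x>0$, $$\mathbf{P}\left(\mathrm{ht}(\mathrm{T})\ge x n^{1/2}\right)<5\exp\left(-\delta x^2/2^{12}\right).$$
   Context: A degree sequence is a sequence of non-negative integers $\mathrm{d}=(d_1,\dots,d_n)$ with $\sum_{i=1}^n d_i=n-1$. In a rooted tree, the degree of a vertex is its number of children. $\mathcal{T}_{\mathrm{d}}$ is the set of rooted labeled trees with vertex set $[n]=\{1,\dots,n\}$ in which, for each $i\in[n]$, vertex $i$ has degree (number of children) $d_i$. For $i\ge 0$, $n_i(\mathrm{d})=|\{j\in[n]:d_j=i\}|$. The height $\mathrm{ht}(\mathrm{t})$ is the maximum graph distance from the root to a vertex. *)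

theory Defs
  imports
    "HOL-Probability.Probability"
    "Graph_Theory.Digraph_Component"
begin

text \<open>
  A finite simple undirected graph is represented, as usual in \<open>Graph_Theory\<close>, by a loop-free
  symmetric digraph without parallel arcs (\<open>pair_graph\<close>). Every edge \<open>{u, v}\<close> then gives a directed
  cycle \<open>u, v, u\<close> of length 2, so the library's \<open>forest\<close> and \<open>tree\<close> do not express undirected
  acyclicity; the cycles of the undirected graph are those of length at least 3.
\<close>

definition undirected_tree :: "'a pair_pre_digraph \<Rightarrow> bool" where
  "undirected_tree G \<longleftrightarrow>
     pair_graph G \<and> Digraph_Component.connected (with_proj G) \<and>
     \<not> (\<exists>p. pre_digraph.cycle (with_proj G) p \<and> length p \<ge> 3)"

type_synonym 'a rooted_graph = "'a pair_pre_digraph \<times> 'a"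

definition rooted_tree :: "'a rooted_graph \<Rightarrow> bool" where
  "rooted_tree t \<longleftrightarrow> (case t of (G, r) \<Rightarrow> undirected_tree G \<and> r \<in> pverts G)"

text \<open>\<open>w\<close> is a child of \<open>v\<close> iff \<open>v\<close> is the last vertex before \<open>w\<close> on the path from the root to \<open>w\<close>.\<close>

definition children :: "'a rooted_graph \<Rightarrow> 'a \<Rightarrow> 'a set" where
  "children t v =
     (case t of (G, r) \<Rightarrow> {w. \<exists>p. pre_digraph.apath (with_proj G) r (p @ [(v, w)]) w})"

definition graph_dist :: "'a pair_pre_digraph \<Rightarrow> 'a \<Rightarrow> 'a \<Rightarrow> nat" where
  "graph_dist G u v = (LEAST k. \<exists>p. pre_digraph.awalk (with_proj G) u p v \<and> length p = k)"

definition tree_height :: "'a rooted_graph \<Rightarrow> nat" where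
  "tree_height t = (case t of (G, r) \<Rightarrow> Max (graph_dist G r ` pverts G))"

text \<open>
  A sequence \<open>(d\<^sub>1, \<dots>, d\<^sub>n)\<close> is given by its length \<open>n\<close> and a function \<open>d\<close> of which only the values on
  \<open>{1..n}\<close> matter. Writing the sum condition without subtraction excludes \<open>n = 0\<close>.
\<close>

definition degree_sequence :: "nat \<Rightarrow> (nat \<Rightarrow> nat) \<Rightarrow> bool" where
  "degree_sequence n d \<longleftrightarrow> (\<Sum>i = 1..n. d i) + 1 = n"

definition degree_count :: "nat \<Rightarrow> (nat \<Rightarrow> nat) \<Rightarrow> nat \<Rightarrow> nat" where
  "degree_count n d i = card {j \<in> {1..n}. d j = i}"

definition labeled_trees :: "nat \<Rightarrow> (nat \<Rightarrow> nat) \<Rightarrow> nat rooted_graph set" where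
  "labeled_trees n d =
     {t. rooted_tree t \<and> pverts (fst t) = {1..n} \<and> (\<forall>i \<in> {1..n}. card (children t i) = d i)}"

end

theory Submission
  imports Defs
begin

text \<open>
  Revealing the path from a leaf up to the root, each new parent is found by drawing one of the
  remaining child slots uniformly at random, apart from one; the path ends as soon as the slot of an
  already seen vertex is drawn. Vertices with at least two children leave slots behind, so with
  \<open>M = \<Sum>{d\<^sub>i. d\<^sub>i \<ge> 2} = n - n\<^sub>1 - 1\<close> a fixed leaf has height at least \<open>h\<close> with probability about
  \<open>exp (- c M h\<^sup>2 / n\<^sup>2)\<close>, and the distance of a leaf to the subtree spanned by \<open>k\<close> other leaves is at
  least \<open>l\<close> with probability about \<open>2\<^sup>-\<^sup>k + exp (- c l sqrt (k M) / n)\<close>. A union bound over all leaves would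
  lose a factor \<open>n\<close>, so one chains: the subtree spanned by the first \<open>k\<^sub>0\<close> leaves, with \<open>k\<^sub>0\<close> of order
  \<open>M h\<^sup>2 / n\<^sup>2\<close>, is at most \<open>h / 2\<close> high, and passing from \<open>4\<^sup>i k\<^sub>0\<close> to \<open>4\<^sup>i\<^sup>+\<^sup>1 k\<^sub>0\<close> leaves
  increases the height by at most \<open>(h / 8) (3 / 4)\<^sup>i\<close>, which sums to \<open>h / 2\<close>.
\<close>

subsection \<open>Counting the trees that extend a partial exploration\<close>

text \<open>The drawing rule comes from \<open>card_ext\<close>: up to the factor
  \<open>arrangements\<close>, a partial exploration has as many completions as the product of the
  free slots of the settled part \<open>S\<close> and a factorial. Closing the open path
  \<open>C\<close> replaces the first factor \<open>slots E g S\<close> by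
  \<open>slots E g S + slots E g C - 1\<close>. Hence one slot is left out of the drawing, the slots
  of \<open>C\<close> count although using one would close a loop, and the law of the next parent
  sees \<open>S\<close> and \<open>C\<close> only through their total. The process is thus governed
  by one number \<open>s\<close>. Paths start at leaves because a leaf offers no slot: opening a
  path does not change the free slots, and no path runs into a leaf that is still to be explored.
  Nothing is lost, since a deepest vertex is a leaf. The constants 5 and \<open>2 ^ 12\<close> fit
  together: for \<delta> x^2 below \<open>2 ^ 12\<close> the claim is trivial because 5 / e exceeds
  1, and beyond that the prefactor linear in z = M h^2 / n^2 left by the union bounds is absorbed by
  the gap between the proven rate z / 100 and the required 2 z / \<open>2 ^ 12\<close>.\<close>

definition steps_on :: "'a set \<Rightarrow> ('a \<Rightarrow> 'a) \<Rightarrow> ('a \<times> 'a) set" where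
  "steps_on E f = {(v, f v) |v. v \<in> E}"

lemma steps_on_rtrancl_mono:
  assumes "(v, w) \<in> (steps_on E f)\<^sup>*" "E \<subseteq> E'" "\<forall>v\<in>E. f v = f' v"
  shows "(v, w) \<in> (steps_on E' f')\<^sup>*"
proof -
  have "steps_on E f \<subseteq> steps_on E' f'"
    using assms(2,3) by (auto simp: steps_on_def)
  then show ?thesis using assms(1) rtrancl_mono by blast
qed

lemma steps_on_rtrancl_closed:
  assumes "(v, w) \<in> (steps_on E f)\<^sup>*" "v \<in> A" "\<And>u. u \<in> A \<Longrightarrow> u \<in> E \<Longrightarrow> f u \<in> A"
  shows "w \<in> A"
  using assms(1,2) by (induction rule: rtrancl_induct) (auto simp: steps_on_def assms(3))

lemma steps_on_rtrancl_into:
  assumes "v \<in> E" "(f v, w) \<in> (steps_on E f)\<^sup>*"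
  shows "(v, w) \<in> (steps_on E f)\<^sup>*"
  using assms by (auto simp: steps_on_def intro: converse_rtrancl_into_rtrancl)

lemma steps_on_rtrancl_step:
  assumes "(w, v) \<in> (steps_on E f)\<^sup>*" "v \<in> E"
  shows "(w, f v) \<in> (steps_on E f)\<^sup>*"
  using assms by (auto simp: steps_on_def intro: rtrancl_into_rtrancl)

lemma steps_on_rtrancl_funpow:
  assumes "(v, w) \<in> (steps_on E f)\<^sup>*"
  shows "\<exists>j. w = (f ^^ j) v"
  using assms
proof (induction rule: rtrancl_induct)
  case base
  show ?case by (rule exI[of _ 0]) simp
next
  case (step y z)
  then obtain j where "y = (f ^^ j) v" by blast
  with step(2) have "z = (f ^^ Suc j) v" by (auto simp: steps_on_def)
  then show ?case by blast
qed

text \<open>Every vertex of \<open>V\<close> fills one child slot of its parent, with the virtual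
  parent \<open>r\<close> of the root counted among the parents; so the slots add up to
  \<open>card V\<close>.\<close>

locale rooted_degrees =
  fixes V :: "'a set" and r :: 'a and D :: "'a \<Rightarrow> nat"
  assumes finite_V: "finite V" and r_notin: "r \<notin> V"
    and sum_D: "(\<Sum>v\<in>insert r V. D v) = card V"
begin

text \<open>A rooted tree on \<open>V\<close> is encoded by its parent function, where \<open>r \<notin> V\<close> is a virtual parent of the
  root (so \<open>D r = 1\<close> later on); then \<open>(f ^^ h) v \<noteq> r\<close> says that \<open>v\<close> has height at least \<open>h\<close>.\<close>

definition trees :: "('a \<Rightarrow> 'a) set" where
  "trees = {f. (\<forall>v. v \<notin> V \<longrightarrow> f v = r) \<and> (\<forall>v\<in>V. f v \<in> insert r V) \<and>
     (\<forall>u\<in>insert r V. card {v\<in>V. f v = u} = D u) \<and>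
     (\<forall>v\<in>V. (v, r) \<in> (steps_on V f)\<^sup>*)}"

definition ext :: "'a set \<Rightarrow> ('a \<Rightarrow> 'a) \<Rightarrow> ('a \<Rightarrow> 'a) set" where
  "ext E g = {f\<in>trees. \<forall>v\<in>E. f v = g v}"

definition rem :: "'a set \<Rightarrow> ('a \<Rightarrow> 'a) \<Rightarrow> 'a \<Rightarrow> nat" where
  "rem E g u = D u - card {v\<in>E. g v = u}"

text \<open>The state between two paths. It is no instance of \<open>explored\<close>, which always
  has an open path with a top.\<close>

definition settled :: "('a \<Rightarrow> 'a) \<Rightarrow> 'a set \<Rightarrow> bool" where
  "settled g S \<longleftrightarrow> r \<in> S \<and> S \<subseteq> insert r V \<and> (\<forall>v\<in>S - {r}. g v \<in> S) \<and>
     (\<forall>v\<in>S. (v, r) \<in> (steps_on (S - {r}) g)\<^sup>*) \<and>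
     (\<forall>u\<in>insert r V. card {v\<in>S - {r}. g v = u} \<le> D u)"

text \<open>\<open>E\<close> is the set of vertices whose parent, given by \<open>g\<close>, has been revealed: the whole of the
  ancestor-closed part \<open>S\<close>, and all but the top \<open>x\<close> of the path \<open>C\<close> that is being followed upwards.\<close>

definition explored :: "'a set \<Rightarrow> ('a \<Rightarrow> 'a) \<Rightarrow> 'a set \<Rightarrow> 'a set \<Rightarrow> 'a \<Rightarrow> bool" where
  "explored E g S C x \<longleftrightarrow> r \<in> S \<and> S \<subseteq> insert r V \<and> C \<subseteq> V \<and> S \<inter> C = {} \<and> x \<in> C \<and>
     E = (S - {r}) \<union> (C - {x}) \<and> (\<forall>v\<in>S - {r}. g v \<in> S) \<and> (\<forall>v\<in>C - {x}. g v \<in> C) \<and>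
     (\<forall>v\<in>S. (v, r) \<in> (steps_on E g)\<^sup>*) \<and> (\<forall>v\<in>C. (v, x) \<in> (steps_on E g)\<^sup>*) \<and>
     (\<forall>u\<in>insert r V. card {v\<in>E. g v = u} \<le> D u)"

lemma finite_trees: "finite trees"
proof -
  have "trees \<subseteq> {f. \<forall>v. (v \<in> V \<longrightarrow> f v \<in> insert r V) \<and> (v \<notin> V \<longrightarrow> f v = r)}"
    by (auto simp: trees_def)
  moreover have "finite {f. \<forall>v. (v \<in> V \<longrightarrow> f v \<in> insert r V) \<and> (v \<notin> V \<longrightarrow> f v = r)}"
    using finite_V by (intro finite_set_of_finite_funs) auto
  ultimately show ?thesis by (rule finite_subset)
qed

lemma finite_ext [simp]: "finite (ext E g)"
  using finite_trees by (auto simp: ext_def)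

lemma settled_explored:
  assumes "settled g S" "y \<in> V - S"
  shows "explored (S - {r}) g S {y} y"
  using assms r_notin unfolding settled_def explored_def by auto

lemma rem_upd:
  assumes "finite E" "x \<notin> E"
  shows "rem (insert x E) (g(x := u)) v = (if v = u then rem E g u - 1 else rem E g v)"
proof -
  have "{w\<in>insert x E. (g(x := u)) w = v} =
      (if v = u then insert x {w\<in>E. g w = u} else {w\<in>E. g w = v})"
    using assms by auto
  then show ?thesis using assms by (auto simp: rem_def)
qed

lemma capacity_upd:
  assumes "finite E" "x \<notin> E" "\<forall>v\<in>insert r V. card {w\<in>E. g w = v} \<le> D v" "rem E g u > 0"
  shows "\<forall>v\<in>insert r V. card {w\<in>insert x E. (g(x := u)) w = v} \<le> D v"
proof
  fix v assume v: "v \<in> insert r V"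
  have *: "{w\<in>insert x E. (g(x := u)) w = v} =
      (if v = u then insert x {w\<in>E. g w = u} else {w\<in>E. g w = v})"
    using assms by auto
  show "card {w\<in>insert x E. (g(x := u)) w = v} \<le> D v"
    unfolding * using assms v by (auto simp: rem_def)
qed

lemma exploredD:
  assumes "explored E g S C x"
  shows "finite E" "finite S" "finite C" "x \<notin> E" "E \<subseteq> V" "x \<in> V" "insert x E = (S \<union> C) - {r}"
    "V - E = insert x (V - S - C)" "x \<notin> V - S - C"
proof -
  show "finite E" "finite S" "finite C" "x \<notin> E" "E \<subseteq> V" "x \<in> V" "insert x E = (S \<union> C) - {r}"
    "V - E = insert x (V - S - C)" "x \<notin> V - S - C"
    using assms finite_V r_notin unfolding explored_def
    by (auto intro: finite_subset)
qed

text \<open>A hit ends the path: through \<open>u\<close> every vertex of \<open>C\<close> now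
  reaches \<open>r\<close>, so \<open>C\<close> joins the settled part.\<close>

lemma explored_to_settled:
  assumes "explored E g S C x" "u \<in> S" "rem E g u > 0"
  shows "settled (g(x := u)) (S \<union> C)"
proof -
  note d = exploredD[OF assms(1)]
  note e = assms(1)[unfolded explored_def]
  have xS: "x \<notin> S" using e by auto
  have eq: "\<forall>v\<in>E. g v = (g(x := u)) v" using d by auto
  have sub: "E \<subseteq> S \<union> C - {r}" using d(7) by auto
  have m: "(v, w) \<in> (steps_on E g)\<^sup>* \<Longrightarrow> (v, w) \<in> (steps_on (S \<union> C - {r}) (g(x := u)))\<^sup>*" for v w
    using steps_on_rtrancl_mono[OF _ sub eq] by blast
  have rS: "(v, r) \<in> (steps_on (S \<union> C - {r}) (g(x := u)))\<^sup>*" if "v \<in> S" for v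
    using e m that by blast
  have "(x, r) \<in> (steps_on (S \<union> C - {r}) (g(x := u)))\<^sup>*"
  proof (rule steps_on_rtrancl_into)
    show "x \<in> S \<union> C - {r}" unfolding d(7)[symmetric] by simp
    show "((g(x := u)) x, r) \<in> (steps_on (S \<union> C - {r}) (g(x := u)))\<^sup>*"
      unfolding fun_upd_same by (rule rS[OF assms(2)])
  qed
  then have rC: "(v, r) \<in> (steps_on (S \<union> C - {r}) (g(x := u)))\<^sup>*" if "v \<in> C" for v
    using e m[of v x] that by (blast intro: rtrancl_trans)
  have cap: "\<forall>v\<in>insert r V. card {w\<in>insert x E. (g(x := u)) w = v} \<le> D v"
    using capacity_upd[OF d(1,4) _ assms(3)] e by blast
  have cl: "\<forall>v\<in>S \<union> C - {r}. (g(x := u)) v \<in> S \<union> C"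
    using e assms(2) by auto
  have "r \<in> S \<union> C" "S \<union> C \<subseteq> insert r V" using e by auto
  then show ?thesis
    unfolding settled_def using cl rS rC cap unfolding d(7) by blast
qed

text \<open>All revealed parents lie in \<open>S\<close> or \<open>C\<close>, so an unseen vertex
  has lost no slot.\<close>

lemma rem_fresh:
  assumes "explored E g S C x" "u \<in> V - S - C"
  shows "rem E g u = D u"
proof -
  have "{v\<in>E. g v = u} = {}"
    using assms unfolding explored_def by auto
  then show ?thesis unfolding rem_def by (simp only: card.empty diff_zero)
qed

lemma explored_step:
  assumes "explored E g S C x" "u \<in> V - S - C" "D u > 0"
  shows "explored (insert x E) (g(x := u)) S (insert u C) u"
proof -
  note d = exploredD[OF assms(1)]
  note e = assms(1)[unfolded explored_def]
  have eq: "\<forall>v\<in>E. g v = (g(x := u)) v" using d by auto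
  have m: "(v, w) \<in> (steps_on E g)\<^sup>* \<Longrightarrow> (v, w) \<in> (steps_on (insert x E) (g(x := u)))\<^sup>*" for v w
    using steps_on_rtrancl_mono[OF _ _ eq] by blast
  have "(x, u) \<in> (steps_on (insert x E) (g(x := u)))\<^sup>*"
    by (rule steps_on_rtrancl_into[where f = "g(x := u)", simplified]) auto
  then have rC: "(v, u) \<in> (steps_on (insert x E) (g(x := u)))\<^sup>*" if "v \<in> C" for v
    using e m[of v x] that by (blast intro: rtrancl_trans)
  have rp: "rem E g u > 0" using rem_fresh[OF assms(1,2)] assms(3) by simp
  have cap: "\<forall>v\<in>insert r V. card {w\<in>insert x E. (g(x := u)) w = v} \<le> D v"
    using capacity_upd[OF d(1,4) _ rp] e by blast
  have E: "insert x E = (S - {r}) \<union> (insert u C - {u})"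
    using e assms(2) r_notin by auto
  have xS: "x \<notin> S" using e by auto
  have "(u, u) \<in> (steps_on (insert x E) (g(x := u)))\<^sup>*" by simp
  then have rC': "\<forall>v\<in>insert u C. (v, u) \<in> (steps_on (insert x E) (g(x := u)))\<^sup>*"
    using rC by blast
  have rS: "\<forall>v\<in>S. (v, r) \<in> (steps_on (insert x E) (g(x := u)))\<^sup>*"
    using e m by blast
  have cS: "\<forall>v\<in>S - {r}. (g(x := u)) v \<in> S" using e xS by auto
  have cC: "\<forall>v\<in>insert u C - {u}. (g(x := u)) v \<in> insert u C" using e by auto
  have "r \<in> S" "S \<subseteq> insert r V" "insert u C \<subseteq> V" "S \<inter> insert u C = {}"
    using e assms(2) by auto
  then show ?thesis unfolding explored_def
    using E cap rC' rS cS cC by blast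
qed

lemma sum_rem:
  assumes "E \<subseteq> V" "\<forall>v\<in>E. g v \<in> insert r V" "\<forall>u\<in>insert r V. card {v\<in>E. g v = u} \<le> D u"
  shows "(\<Sum>u\<in>insert r V. rem E g u) = card (V - E)"
proof -
  have fE: "finite E" using assms(1) finite_V by (rule finite_subset)
  have "(\<Sum>u\<in>insert r V. rem E g u) = (\<Sum>u\<in>insert r V. D u) - (\<Sum>u\<in>insert r V. card {v\<in>E. g v = u})"
    unfolding rem_def using assms(3) by (intro sum_subtractf_nat) auto
  also have "(\<Sum>u\<in>insert r V. card {v\<in>E. g v = u}) = card E"
  proof -
    have "(\<Sum>u\<in>insert r V. card {v\<in>E. g v = u}) = (\<Sum>u\<in>insert r V. \<Sum>v\<in>{v\<in>E. g v = u}. 1)"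
      by simp
    also have "\<dots> = (\<Sum>v\<in>E. 1)"
      using fE finite_V assms(2) by (intro sum.group) auto
    finally show ?thesis by simp
  qed
  finally show ?thesis using sum_D card_Diff_subset[OF fE assms(1)] by simp
qed

lemma explored_range:
  assumes "explored E g S C x"
  shows "\<forall>v\<in>E. g v \<in> insert r V"
  using assms unfolding explored_def by blast

section \<open>Free slots and the number of completions\<close>

definition slots :: "'a set \<Rightarrow> ('a \<Rightarrow> 'a) \<Rightarrow> 'a set \<Rightarrow> nat" where
  "slots E g S = (\<Sum>u\<in>S. rem E g u)"

lemma sum_explored:
  assumes "explored E g S C x"
  shows "(\<Sum>u\<in>insert r V. h u) = (\<Sum>u\<in>S. h u) + (\<Sum>u\<in>C. h u) + (\<Sum>u\<in>V - S - C. (h u :: nat))"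
proof -
  note d = exploredD[OF assms]
  have V: "insert r V = S \<union> C \<union> (V - S - C)" and dis: "S \<inter> C = {}" "(S \<union> C) \<inter> (V - S - C) = {}"
    using assms unfolding explored_def by auto
  have fin: "finite (S \<union> C)" "finite (V - S - C)" using d(2,3) finite_V by auto
  have "sum h (insert r V) = sum h (S \<union> C \<union> (V - S - C))" by (subst V) (rule refl)
  then show ?thesis
    unfolding sum.union_disjoint[OF fin dis(2)] sum.union_disjoint[OF d(2,3) dis(1)] .
qed

text \<open>Free slots and vertices still without a parent are equally many. The latter are the
  unseen vertices and the top \<open>x\<close>, whence the \<open>Suc\<close>.\<close>

lemma slots_total:
  assumes "explored E g S C x"
  shows "slots E g S + slots E g C + (\<Sum>u\<in>V - S - C. D u) = Suc (card (V - S - C))"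
proof -
  note d = exploredD[OF assms]
  note e = assms[unfolded explored_def]
  have "(\<Sum>u\<in>insert r V. rem E g u) =
      slots E g S + slots E g C + (\<Sum>u\<in>V - S - C. rem E g u)"
    unfolding slots_def by (rule sum_explored[OF assms])
  also have "(\<Sum>u\<in>V - S - C. rem E g u) = (\<Sum>u\<in>V - S - C. D u)"
    using rem_fresh[OF assms] by simp
  finally show ?thesis
    using sum_rem[OF d(5) explored_range[OF assms]] e
    unfolding d(8) card_insert_disjoint[OF finite_Diff[OF finite_Diff[OF finite_V]] d(9)] by metis
qed

lemma ext_split:
  assumes "x \<in> V" "x \<notin> E"
  shows "card {f\<in>ext E g. P f} = (\<Sum>u\<in>insert r V. card {f\<in>ext (insert x E) (g(x := u)). P f})"
proof -
  have "{f\<in>ext E g. P f} = (\<Union>u\<in>insert r V. {f\<in>ext (insert x E) (g(x := u)). P f})"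
    using assms by (auto simp: ext_def trees_def split: if_splits)
  also have "card \<dots> = (\<Sum>u\<in>insert r V. card {f\<in>ext (insert x E) (g(x := u)). P f})"
  proof (rule card_UN_disjoint)
    show "\<forall>u\<in>insert r V. finite {f\<in>ext (insert x E) (g(x := u)). P f}" by simp
  qed (use finite_V in \<open>auto simp: ext_def\<close>)
  finally show ?thesis .
qed

text \<open>A parent in \<open>C\<close> for the top would make \<open>C\<close> closed under the
  parent function, so \<open>x\<close> could never reach \<open>r\<close>.\<close>

lemma ext_loop_empty:
  assumes "explored E g S C x" "u \<in> C"
  shows "ext (insert x E) (g(x := u)) = {}"
proof (rule ccontr)
  assume "ext (insert x E) (g(x := u)) \<noteq> {}"
  then obtain f where f: "f \<in> trees" "\<forall>v\<in>insert x E. f v = (g(x := u)) v"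
    by (auto simp: ext_def)
  note e = assms(1)[unfolded explored_def]
  have "f v \<in> C" if "v \<in> C" for v
    using e f(2) assms(2) that by (cases "v = x") auto
  moreover have "(x, r) \<in> (steps_on V f)\<^sup>*" using f(1) exploredD(6)[OF assms(1)] by (auto simp: trees_def)
  moreover have "x \<in> C" using e by blast
  ultimately have "r \<in> C" using steps_on_rtrancl_closed[of x r V f C] by blast
  then show False using e r_notin by auto
qed

lemma ext_full_empty:
  assumes "explored E g S C x" "u \<in> insert r V" "rem E g u = 0"
  shows "ext (insert x E) (g(x := u)) = {}"
proof (rule ccontr)
  assume "ext (insert x E) (g(x := u)) \<noteq> {}"
  then obtain f where f: "f \<in> trees" "\<forall>v\<in>insert x E. f v = (g(x := u)) v"
    by (auto simp: ext_def)
  note d = exploredD[OF assms(1)]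
  note e = assms(1)[unfolded explored_def]
  have "insert x {v\<in>E. g v = u} \<subseteq> {v\<in>V. f v = u}"
    using f(2) d(4,5,6) by (auto split: if_splits)
  then have le: "card (insert x {v\<in>E. g v = u}) \<le> card {v\<in>V. f v = u}"
    using finite_V by (intro card_mono) auto
  have "Suc (card {v\<in>E. g v = u}) \<le> D u"
  proof -
    have "card {v\<in>V. f v = u} = D u" using f(1) assms(2) unfolding trees_def by blast
    moreover have "card (insert x {v\<in>E. g v = u}) = Suc (card {v\<in>E. g v = u})"
      using d(1,4) by (intro card_insert_disjoint) auto
    ultimately show ?thesis using le by simp
  qed
  then show False using assms(3) by (simp add: rem_def)
qed

text \<open>No vertex is left without a parent, so no slot is left either: all capacity bounds are
  equalities, and \<open>g\<close>, reset to \<open>r\<close> outside \<open>V\<close>, is the only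
  completion.\<close>

lemma ext_settled_full:
  assumes "settled g (insert r V)"
  shows "card (ext V g) = 1" "\<forall>u\<in>insert r V. rem V g u = 0"
proof -
  have V: "insert r V - {r} = V" using r_notin by auto
  note s = assms[unfolded settled_def V]
  have "(\<Sum>u\<in>insert r V. rem V g u) = card (V - V)"
    using s r_notin by (intro sum_rem) auto
  then show rem: "\<forall>u\<in>insert r V. rem V g u = 0"
    using finite_V by simp
  have D: "card {v\<in>V. g v = u} = D u" if "u \<in> insert r V" for u
    using rem s that by (auto simp: rem_def simp del: insert_iff intro: le_antisym)
  define f where "f v = (if v \<in> V then g v else r)" for v
  have "{v\<in>V. f v = u} = {v\<in>V. g v = u}" for u by (auto simp: f_def)
  moreover have "(v, r) \<in> (steps_on V f)\<^sup>*" if "v \<in> V" for v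
    by (rule steps_on_rtrancl_mono[where E = V and f = g]) (use s that in \<open>auto simp: f_def\<close>)
  moreover have "f v \<in> insert r V" if "v \<in> V" for v
    using s that r_notin by (auto simp: f_def)
  ultimately have "f \<in> trees" using D by (simp add: trees_def f_def)
  then have "ext V g = {f}" by (auto simp: ext_def f_def trees_def)
  then show "card (ext V g) = 1" by simp
qed

text \<open>The number of ways to order the free slots of each vertex. A completion weighted by it
  is an assignment of children to distinguishable slots, which has a product formula without
  division.\<close>

definition arrangements :: "'a set \<Rightarrow> ('a \<Rightarrow> 'a) \<Rightarrow> nat" where
  "arrangements E g = (\<Prod>u\<in>insert r V. fact (rem E g u))"

lemma arrangements_upd:
  assumes "finite E" "x \<notin> E" "u \<in> insert r V" "rem E g u > 0"
  shows "arrangements E g = rem E g u * arrangements (insert x E) (g(x := u))"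
proof -
  have f: "fact (rem E g u) = rem E g u * fact (rem E g u - 1)"
    using assms(4) by (simp add: fact_reduce)
  show ?thesis
    unfolding arrangements_def rem_upd[OF assms(1,2)]
      prod.remove[OF finite.insertI[OF finite_V] assms(3)]
    by (simp only: f if_True refl mult.assoc) (auto intro!: prod.cong)
qed

lemma arrangements_pos: "arrangements E g > 0"
  by (simp add: arrangements_def prod_pos)

lemma slots_upd_fresh:
  assumes "explored E g S C x" "u \<in> V - S - C" "D u > 0"
  shows "slots (insert x E) (g(x := u)) S = slots E g S"
    "slots (insert x E) (g(x := u)) (insert u C) = slots E g C + D u - 1"
proof -
  note d = exploredD[OF assms(1)]
  show "slots (insert x E) (g(x := u)) S = slots E g S"
    unfolding slots_def rem_upd[OF d(1,4)] using assms(2) by (intro sum.cong) auto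
  have "slots (insert x E) (g(x := u)) C = slots E g C"
    unfolding slots_def rem_upd[OF d(1,4)] using assms(2) by (intro sum.cong) auto
  moreover have "rem (insert x E) (g(x := u)) u = D u - 1"
    using rem_upd[OF d(1,4)] rem_fresh[OF assms(1,2)] by simp
  moreover have "slots (insert x E) (g(x := u)) (insert u C) =
      rem (insert x E) (g(x := u)) u + slots (insert x E) (g(x := u)) C"
    unfolding slots_def using assms(2) d(3) by (intro sum.insert) auto
  ultimately show "slots (insert x E) (g(x := u)) (insert u C) = slots E g C + D u - 1"
    using assms(3) by simp
qed

lemma slots_upd_hit:
  assumes "explored E g S C x" "u \<in> S" "rem E g u > 0"
  shows "slots (insert x E) (g(x := u)) (S \<union> C) = slots E g S + slots E g C - 1"
proof -
  note d = exploredD[OF assms(1)]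
  note e = assms(1)[unfolded explored_def]
  have "slots (insert x E) (g(x := u)) (S \<union> C) =
      slots (insert x E) (g(x := u)) S + slots (insert x E) (g(x := u)) C"
    unfolding slots_def using e d(2,3) by (intro sum.union_disjoint) auto
  moreover have "slots (insert x E) (g(x := u)) C = slots E g C"
    unfolding slots_def rem_upd[OF d(1,4)] using assms(2) e by (intro sum.cong) auto
  moreover have "slots (insert x E) (g(x := u)) S = slots E g S - 1"
  proof -
    have "slots (insert x E) (g(x := u)) S =
        (rem E g u - 1) + (\<Sum>v\<in>S - {u}. rem (insert x E) (g(x := u)) v)"
      unfolding slots_def sum.remove[OF d(2) assms(2)] rem_upd[OF d(1,4)] by simp
    also have "(\<Sum>v\<in>S - {u}. rem (insert x E) (g(x := u)) v) = (\<Sum>v\<in>S - {u}. rem E g v)"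
      unfolding rem_upd[OF d(1,4)] by (intro sum.cong) auto
    finally show ?thesis using assms(3)
      unfolding slots_def sum.remove[OF d(2) assms(2)] by simp
  qed
  moreover have "slots E g S > 0"
    unfolding slots_def sum.remove[OF d(2) assms(2)] using assms(3) by simp
  ultimately show ?thesis by simp
qed

lemma explored_last:
  assumes "explored E g S C x" "V - S - C = {}" "u \<in> S" "rem E g u > 0"
  shows "card (ext (insert x E) (g(x := u))) = 1" "arrangements E g = 1" "slots E g S = 1"
proof -
  note d = exploredD[OF assms(1)]
  note e = assms(1)[unfolded explored_def]
  have SC: "S \<union> C = insert r V" using assms(2) e by auto
  then have E: "insert x E = V" using d(7) r_notin by auto
  note full = ext_settled_full[OF explored_to_settled[OF assms(1,3,4), unfolded SC]]
  show "card (ext (insert x E) (g(x := u))) = 1" unfolding E by (rule full(1))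
  have uV: "u \<in> insert r V" using assms(3) e by auto
  have "rem V (g(x := u)) u = 0" by (rule bspec[OF full(2) uV])
  then have "rem E g u = 1"
    using rem_upd[OF d(1,4), of g u u] assms(4) unfolding E by simp
  moreover have "arrangements V (g(x := u)) = 1"
    unfolding arrangements_def by (rule prod.neutral) (use full(2) in simp)
  ultimately show "arrangements E g = 1"
    using arrangements_upd[OF d(1,4) uV assms(4)] unfolding E by simp
  have "slots E g S \<ge> rem E g u"
    unfolding slots_def using assms(3) d(2) by (intro member_le_sum) auto
  then show "slots E g S = 1"
    using slots_total[OF assms(1)] assms(2,4) \<open>rem E g u = 1\<close>
    by (simp del: Diff_eq_empty_iff)
qed

text \<open>Condition on the next parent \<open>u\<close>. Up to a common
  \<open>fact (card ?Y - 1)\<close>, a hit in \<open>S\<close> has weight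
  \<open>rem E g u * (slots E g S + slots E g C - 1)\<close>, an unseen vertex
  \<open>D u * slots E g S\<close>, and \<open>slots_total\<close> collapses the sum to
  \<open>slots E g S * card ?Y\<close>. With nothing revealed and \<open>D r = 1\<close> this is the
  classical count (n - 1)! divided by the product of all \<open>fact (D u)\<close>.\<close>

theorem card_ext:
  assumes "explored E g S C x"
  shows "card (ext E g) * arrangements E g = slots E g S * fact (card (V - S - C))"
  using assms
proof (induction "card (V - E)" arbitrary: E g S C x rule: less_induct)
  case less
  note d = exploredD[OF less.prems]
  note e = less.prems[unfolded explored_def]
  let ?E = "insert x E" and ?g = "\<lambda>u. g(x := u)" and ?Y = "V - S - C"
  have dec: "card (V - ?E) < card (V - E)"
    using d(4,6) finite_V by (intro psubset_card_mono) auto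
  have loop: "card (ext ?E (?g u)) = 0" if "u \<in> C" for u
    using ext_loop_empty[OF less.prems that] by simp
  have full: "card (ext ?E (?g u)) = 0" if "u \<in> insert r V" "rem E g u = 0" for u
    using ext_full_empty[OF less.prems that] by simp
  have V: "insert r V = S \<union> C \<union> ?Y" using e by auto
  have split: "(\<Sum>u\<in>insert r V. h u) = (\<Sum>u\<in>S. h u) + (\<Sum>u\<in>C. h u) + (\<Sum>u\<in>?Y. h u)"
    for h :: "'a \<Rightarrow> nat"
    by (rule sum_explored[OF less.prems])
  have "card (ext E g) = (\<Sum>u\<in>insert r V. card (ext ?E (?g u)))"
    using ext_split[OF d(6,4), where P = "\<lambda>_. True"] by simp
  also have "\<dots> = (\<Sum>u\<in>S. card (ext ?E (?g u))) + (\<Sum>u\<in>?Y. card (ext ?E (?g u)))"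
    unfolding split using loop by simp
  finally have card: "card (ext E g) =
      (\<Sum>u\<in>S. card (ext ?E (?g u))) + (\<Sum>u\<in>?Y. card (ext ?E (?g u)))" .
  show ?case
  proof (cases "?Y = {}")
    case True
    have tot: "slots E g S + slots E g C = 1"
      using slots_total[OF less.prems] unfolding True by simp
    show ?thesis
    proof (cases "\<exists>u\<in>S. rem E g u > 0")
      case False
      then have "slots E g S = 0" by (simp add: slots_def)
      moreover have "card (ext E g) = 0"
        unfolding card True using full False V by simp
      ultimately show ?thesis by simp
    next
      case hit: True
      then obtain u where u: "u \<in> S" "rem E g u > 0" by blast
      note last = explored_last[OF less.prems True u]
      have "rem E g u + (\<Sum>v\<in>S - {u}. rem E g v) = 1"
        using last(3) unfolding slots_def sum.remove[OF d(2) u(1)] .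
      then have "(\<Sum>v\<in>S - {u}. rem E g v) = 0" using u(2) by simp
      then have "rem E g v = 0" if "v \<in> S - {u}" for v
        using d(2) that by (simp add: sum_eq_0_iff)
      then have "(\<Sum>v\<in>S - {u}. card (ext ?E (?g v))) = 0"
        using full V by (intro sum.neutral) auto
      then have "card (ext E g) = 1"
        unfolding card True sum.remove[OF d(2) u(1)] using last(1) by simp
      then show ?thesis unfolding True last by simp
    qed
  next
    case False
    \<comment> \<open>After a hit no path is open, but the induction hypothesis needs one. Any
      unseen \<open>y\<close> may open it, since the formula does not depend on this choice.\<close>
    then obtain y where y: "y \<in> V - (S \<union> C)" by auto
    have hit: "card (ext ?E (?g u)) * arrangements E g =
        rem E g u * ((slots E g S + slots E g C - 1) * fact (card ?Y - 1))" if u: "u \<in> S" for u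
    proof (cases "rem E g u = 0")
      case True
      then show ?thesis using full[OF _ True] u V by simp
    next
      case False
      then have pos: "rem E g u > 0" by simp
      have uV: "u \<in> insert r V" using u e by auto
      have "explored ?E (?g u) (S \<union> C) {y} y"
        using settled_explored[OF explored_to_settled[OF less.prems u pos] y]
        unfolding d(7)[symmetric] .
      from less.hyps[OF dec this]
      have "card (ext ?E (?g u)) * arrangements ?E (?g u) =
          (slots E g S + slots E g C - 1) * fact (card (V - (S \<union> C) - {y}))"
        unfolding slots_upd_hit[OF less.prems u pos] .
      moreover have "V - (S \<union> C) = ?Y" by auto
      moreover have "card (?Y - {y}) = card ?Y - 1"
        using y by (intro card_Diff_singleton) auto
      ultimately have "card (ext ?E (?g u)) * arrangements ?E (?g u) =
          (slots E g S + slots E g C - 1) * fact (card ?Y - 1)"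
        by metis
      then show ?thesis
        unfolding arrangements_upd[OF d(1,4) uV pos] by (simp only: mult.left_commute)
    qed
    have fresh: "card (ext ?E (?g u)) * arrangements E g =
        D u * (slots E g S * fact (card ?Y - 1))" if u: "u \<in> ?Y" for u
    proof (cases "D u = 0")
      case True
      then show ?thesis using full[of u] u rem_fresh[OF less.prems u] by simp
    next
      case False
      then have pos: "D u > 0" by simp
      have uV: "u \<in> insert r V" using u by auto
      have rem: "rem E g u = D u" by (rule rem_fresh[OF less.prems u])
      have rpos: "rem E g u > 0" using rem pos by simp
      from less.hyps[OF dec explored_step[OF less.prems u pos]]
      have "card (ext ?E (?g u)) * arrangements ?E (?g u) =
          slots E g S * fact (card (V - S - insert u C))"
        unfolding slots_upd_fresh[OF less.prems u pos] .
      moreover have "V - S - insert u C = ?Y - {u}" by auto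
      moreover have "card (?Y - {u}) = card ?Y - 1"
        using u by (intro card_Diff_singleton) auto
      ultimately have "card (ext ?E (?g u)) * arrangements ?E (?g u) =
          slots E g S * fact (card ?Y - 1)" by metis
      then show ?thesis
        unfolding arrangements_upd[OF d(1,4) uV rpos] rem by (simp only: mult.left_commute)
    qed
    have "card (ext E g) * arrangements E g =
        (\<Sum>u\<in>S. rem E g u * ((slots E g S + slots E g C - 1) * fact (card ?Y - 1))) +
        (\<Sum>u\<in>?Y. D u * (slots E g S * fact (card ?Y - 1)))"
      unfolding card add_mult_distrib sum_distrib_right
      by (intro arg_cong2[where f = "(+)"] sum.cong refl hit fresh)
    also have "\<dots> = slots E g S * (slots E g S + slots E g C - 1 + (\<Sum>u\<in>?Y. D u)) * fact (card ?Y - 1)"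
      unfolding sum_distrib_right[symmetric] slots_def[of E g S, symmetric] by (simp add: algebra_simps)
    also have "\<dots> = slots E g S * (card ?Y * fact (card ?Y - 1))"
    \<comment> \<open>The truncated \<open>- 1\<close> is a true subtraction only if
      \<open>S\<close> has a free slot; otherwise both sides vanish.\<close>
    proof (cases "slots E g S = 0")
      case False
      then have "slots E g S + slots E g C - 1 + (\<Sum>u\<in>?Y. D u) = card ?Y"
        using slots_total[OF less.prems] by linarith
      then show ?thesis by (simp only: mult.assoc)
    qed simp
    also have "card ?Y * fact (card ?Y - 1) = fact (card ?Y)"
    proof -
      have "card ?Y > 0" using False finite_V by (simp add: card_gt_0_iff)
      then show ?thesis by (simp add: fact_reduce)
    qed
    finally show ?thesis .
  qed
qed

end

subsection \<open>Supermartingale bounds for the exploration\<close>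

context rooted_degrees begin

text \<open>The quotient of two instances of \<open>card_ext\<close>: the factorials leave
  \<open>card (V - S - C)\<close> and the arrangements leave \<open>D u\<close>.\<close>

lemma card_ext_fresh:
  assumes "explored E g S C x" "u \<in> V - S - C"
  shows "card (V - S - C) * card (ext (insert x E) (g(x := u))) = D u * card (ext E g)"
proof (cases "D u = 0")
  case True
  have "u \<in> insert r V" using assms(2) by simp
  then show ?thesis
    using True ext_full_empty[OF assms(1)] rem_fresh[OF assms] by simp
next
  case False
  let ?Y = "V - S - C" and ?e' = "card (ext (insert x E) (g(x := u)))"
  let ?a' = "arrangements (insert x E) (g(x := u))"
  have pos: "D u > 0" using False by simp
  note d = exploredD[OF assms(1)]
  have uV: "u \<in> insert r V" using assms(2) by simp
  have rem: "rem E g u = D u" by (rule rem_fresh[OF assms])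
  have Y: "V - S - insert u C = ?Y - {u}" by auto
  have "?e' * ?a' = slots E g S * fact (card (?Y - {u}))"
    using card_ext[OF explored_step[OF assms pos]]
    unfolding slots_upd_fresh[OF assms pos] Y .
  moreover have "card (?Y - {u}) = card ?Y - 1" using assms(2) by (intro card_Diff_singleton)
  moreover have "card ?Y > 0" using assms(2) finite_V by (auto simp: card_gt_0_iff)
  ultimately have "card ?Y * ?e' * ?a' = slots E g S * fact (card ?Y)"
    by (simp add: fact_reduce mult.assoc mult.left_commute)
  also have "\<dots> = card (ext E g) * arrangements E g"
    using card_ext[OF assms(1)] by simp
  also have "arrangements E g = D u * ?a'"
    using arrangements_upd[OF d(1,4) uV] rem pos by simp
  finally have "(card ?Y * ?e') * ?a' = (D u * card (ext E g)) * ?a'"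
    by (simp only: mult.assoc mult.commute mult.left_commute)
  then show ?thesis using arrangements_pos[of "insert x E" "g(x := u)"] by (metis mult_right_cancel neq0_conv)
qed

lemma ext_split_explored:
  assumes "explored E g S C x"
  shows "card {f\<in>ext E g. P f} = (\<Sum>u\<in>S. card {f\<in>ext (insert x E) (g(x := u)). P f}) +
    (\<Sum>u\<in>V - S - C. card {f\<in>ext (insert x E) (g(x := u)). P f})"
proof -
  note d = exploredD[OF assms]
  have "(\<Sum>u\<in>C. card {f\<in>ext (insert x E) (g(x := u)). P f}) = 0"
    using ext_loop_empty[OF assms] by (intro sum.neutral) auto
  then show ?thesis
    unfolding ext_split[OF d(6,4)] sum_explored[OF assms] by simp
qed

text \<open>The complement of \<open>card_ext_fresh\<close>: loops are impossible, and by
  \<open>slots_total\<close> the degrees of the unseen vertices fall short of their number by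
  exactly \<open>slots E g S + slots E g C - 1\<close>.\<close>

lemma card_ext_hit:
  assumes "explored E g S C x"
  shows "card (V - S - C) * (\<Sum>u\<in>S. card (ext (insert x E) (g(x := u)))) =
    (slots E g S + slots E g C - 1) * card (ext E g)"
proof -
  let ?Y = "V - S - C" and ?e = "\<lambda>u. card (ext (insert x E) (g(x := u)))"
  have "card ?Y * card (ext E g) = card ?Y * (\<Sum>u\<in>S. ?e u) + (\<Sum>u\<in>?Y. card ?Y * ?e u)"
    using ext_split_explored[OF assms, of "\<lambda>_. True"] by (simp add: algebra_simps sum_distrib_left)
  also have "(\<Sum>u\<in>?Y. card ?Y * ?e u) = (\<Sum>u\<in>?Y. D u) * card (ext E g)"
    unfolding sum_distrib_right by (intro sum.cong card_ext_fresh[OF assms] refl)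
  finally have eq: "card ?Y * card (ext E g) =
      card ?Y * (\<Sum>u\<in>S. ?e u) + (\<Sum>u\<in>?Y. D u) * card (ext E g)" .
  show ?thesis
  proof (cases "slots E g S = 0")
    case True
    then have "card (ext E g) * arrangements E g = 0" using card_ext[OF assms] by simp
    then have "card (ext E g) = 0" using arrangements_pos[of E g] by simp
    then show ?thesis using eq by simp
  next
    case False
    then have "card ?Y = (slots E g S + slots E g C - 1) + (\<Sum>u\<in>?Y. D u)"
      using slots_total[OF assms] by simp
    then have "card ?Y * card (ext E g) =
        (slots E g S + slots E g C - 1) * card (ext E g) + (\<Sum>u\<in>?Y. D u) * card (ext E g)"
      by (simp add: add_mult_distrib)
    then show ?thesis using eq by simp
  qed
qed

text \<open>With \<open>s = slots E g S + slots E g C - 1\<close>, the revealed parent of \<open>x\<close> is a given unseen vertex \<open>u\<close> with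
  probability \<open>D u / card (V - S - C)\<close> and lies in \<open>S\<close> with probability \<open>s / card (V - S - C)\<close>.\<close>

lemma event_step:
  fixes A :: real and B :: "'a \<Rightarrow> real"
  assumes "explored E g S C x"
    and A: "\<And>u. u \<in> S \<Longrightarrow> rem E g u > 0 \<Longrightarrow>
      real (card {f\<in>ext (insert x E) (g(x := u)). P f}) \<le> A * card (ext (insert x E) (g(x := u)))"
    and B: "\<And>u. u \<in> V - S - C \<Longrightarrow> D u > 0 \<Longrightarrow>
      real (card {f\<in>ext (insert x E) (g(x := u)). P f}) \<le> B u * card (ext (insert x E) (g(x := u)))"
  shows "real (card (V - S - C)) * card {f\<in>ext E g. P f} \<le>
    (real (slots E g S + slots E g C - 1) * A + (\<Sum>u\<in>V - S - C. D u * B u)) * card (ext E g)"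
proof -
  let ?Y = "V - S - C" and ?e = "\<lambda>u. ext (insert x E) (g(x := u))"
  note e = assms(1)[unfolded explored_def]
  have A': "real (card {f\<in>?e u. P f}) \<le> A * card (?e u)" if "u \<in> S" for u
  proof (cases "rem E g u = 0")
    case True
    have "u \<in> insert r V" using e that by blast
    then show ?thesis using ext_full_empty[OF assms(1) _ True] by simp
  qed (use A that in simp)
  have B': "real (card {f\<in>?e u. P f}) \<le> B u * card (?e u)" if "u \<in> ?Y" for u
  proof (cases "D u = 0")
    case True
    have "u \<in> insert r V" using that by simp
    then show ?thesis using ext_full_empty[OF assms(1)] rem_fresh[OF assms(1) that] True by simp
  qed (use B that in simp)
  have "real (card {f\<in>ext E g. P f}) =
      (\<Sum>u\<in>S. real (card {f\<in>?e u. P f})) + (\<Sum>u\<in>?Y. real (card {f\<in>?e u. P f}))"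
    unfolding ext_split_explored[OF assms(1)] by simp
  also have "\<dots> \<le> (\<Sum>u\<in>S. A * card (?e u)) + (\<Sum>u\<in>?Y. B u * card (?e u))"
    using A' B' by (intro add_mono sum_mono) auto
  finally have "real (card ?Y) * card {f\<in>ext E g. P f} \<le>
      real (card ?Y) * ((\<Sum>u\<in>S. A * card (?e u)) + (\<Sum>u\<in>?Y. B u * card (?e u)))"
    by (intro mult_left_mono) auto
  also have "\<dots> = A * real (card ?Y * (\<Sum>u\<in>S. card (?e u))) + (\<Sum>u\<in>?Y. B u * real (card ?Y * card (?e u)))"
    by (simp add: algebra_simps sum_distrib_left)
  also have "(\<Sum>u\<in>?Y. B u * real (card ?Y * card (?e u))) = (\<Sum>u\<in>?Y. B u * real (D u * card (ext E g)))"
    using card_ext_fresh[OF assms(1)] by (intro sum.cong) auto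
  also have "A * real (card ?Y * (\<Sum>u\<in>S. card (?e u))) + \<dots> =
      (real (slots E g S + slots E g C - 1) * A + (\<Sum>u\<in>?Y. D u * B u)) * card (ext E g)"
    unfolding card_ext_hit[OF assms(1)] of_nat_mult distrib_right sum_distrib_right
    by (intro arg_cong2[where f = "(+)"] sum.cong refl) (simp_all only: mult.assoc mult.commute mult.left_commute)
  finally show ?thesis .
qed

text \<open>For \<open>Y = V\<close> this is the \<open>M\<close> of the overview; for the unseen
  vertices it is what the walk can still collect.\<close>

definition bigs :: "'a set \<Rightarrow> nat" where
  "bigs Y = (\<Sum>u\<in>Y. if 2 \<le> D u then D u else 0)"

lemma bigs_remove:
  assumes "finite Y" "u \<in> Y"
  shows "bigs Y = (if 2 \<le> D u then D u else 0) + bigs (Y - {u})"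
  unfolding bigs_def by (rule sum.remove[OF assms])

lemma bigs_le:
  assumes "finite Y" shows "bigs Y \<le> (\<Sum>u\<in>Y. D u)"
  unfolding bigs_def by (intro sum_mono) auto

text \<open>Meeting a vertex with \<open>D u >= 2\<close> takes \<open>D u\<close> from
  \<open>bigs\<close> and adds \<open>D u - 1\<close>, at least half of it, to \<open>s\<close>; a
  vertex with one child changes neither. This is the origin of the factor 2.\<close>

lemma bigs_step:
  assumes "Y \<subseteq> V" "u \<in> Y" "D u > 0" "m \<le> 2 * (s + k) + bigs Y"
  shows "m \<le> 2 * (s + D u - 1 + k) + bigs (Y - {u})"
proof -
  have "finite Y" using assms(1) finite_V by (rule finite_subset)
  from bigs_remove[OF this assms(2)] show ?thesis using assms(3,4) by (auto split: if_splits)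
qed

lemma ext_empty_if_no_slots:
  assumes "explored E g S C x" "slots E g S = 0"
  shows "ext E g = {}"
  using card_ext[OF assms(1)] assms(2) arrangements_pos[of E g] by simp

text \<open>\<open>\<Phi>\<close> and \<open>\<Psi>\<close> below are supermartingales of the exploration. Every vertex with at least two
  children that has been seen leaves behind at least half of its slots, up to the \<open>k - j\<close> slots that
  were used to close paths; this is the invariant relating \<open>s\<close> and \<open>bigs\<close>.\<close>

theorem path_event:
  fixes \<Phi> :: "nat \<Rightarrow> nat \<Rightarrow> real" and M :: nat
  assumes \<Phi>_nonneg: "\<And>t s. \<Phi> t s \<ge> 0" and \<Phi>_0: "\<And>s. \<Phi> 0 s \<ge> 1"
    and \<Phi>_Suc: "\<And>t s Y. Y \<subseteq> V \<Longrightarrow> M \<le> 2 * s + bigs Y \<Longrightarrow> s + (\<Sum>u\<in>Y. D u) \<le> card V \<Longrightarrow>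
      (\<Sum>u\<in>Y. D u * \<Phi> t (s + D u - 1)) \<le> (s + (\<Sum>u\<in>Y. D u)) * \<Phi> (Suc t) s"
    and "explored E g S C x" "\<And>f. f \<in> ext E g \<Longrightarrow> (f ^^ c) l = x"
    and "M \<le> 2 * (slots E g S + slots E g C - 1) + bigs (V - S - C)"
  shows "real (card {f\<in>ext E g. \<forall>i\<le>c + t. (f ^^ i) l \<notin> S}) \<le>
    \<Phi> t (slots E g S + slots E g C - 1) * card (ext E g)"
  using assms(4-)
proof (induction t arbitrary: E g C x c)
  case 0
  have "real (card {f\<in>ext E g. \<forall>i\<le>c + 0. (f ^^ i) l \<notin> S}) \<le> card (ext E g)"
    by (intro of_nat_mono card_mono) auto
  also have "\<dots> \<le> \<Phi> 0 (slots E g S + slots E g C - 1) * card (ext E g)"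
    using \<Phi>_0 mult_right_mono[of 1 _ "real (card (ext E g))"] by simp
  finally show ?case .
next
  case (Suc t)
  note ex = Suc.prems(1) and top = Suc.prems(2) and inv = Suc.prems(3)
  note d = exploredD[OF ex]
  let ?Y = "V - S - C" and ?s = "slots E g S + slots E g C - 1"
  let ?P = "\<lambda>f. \<forall>i\<le>c + Suc t. (f ^^ i) l \<notin> S"
  show ?case
  proof (cases "slots E g S = 0")
    case True
    then show ?thesis using ext_empty_if_no_slots[OF ex] by simp
  next
    case False
    have Y: "card ?Y = ?s + (\<Sum>u\<in>?Y. D u)"
      using slots_total[OF ex] False by simp
    have next_top: "(f ^^ Suc c) l = u" if "f \<in> ext (insert x E) (g(x := u))" for f u
    proof -
      have "f \<in> ext E g" using that d(4) by (auto simp: ext_def split: if_splits)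
      moreover have "f x = u" using that by (simp add: ext_def)
      ultimately show ?thesis using top by simp
    qed
    have hit: "real (card {f\<in>ext (insert x E) (g(x := u)). ?P f}) \<le>
        0 * real (card (ext (insert x E) (g(x := u))))" if "u \<in> S" for u
    proof -
      have "\<not> ?P f" if "f \<in> ext (insert x E) (g(x := u))" for f
        using next_top[OF that] \<open>u \<in> S\<close> by (intro notI) (drule spec[where x = "Suc c"], simp)
      then have "{f\<in>ext (insert x E) (g(x := u)). ?P f} = {}" by blast
      then show ?thesis by (simp only: card.empty mult_zero_left of_nat_0 order_refl)
    qed
    have fresh: "real (card {f\<in>ext (insert x E) (g(x := u)). ?P f}) \<le>
        \<Phi> t (?s + D u - 1) * card (ext (insert x E) (g(x := u)))" if u: "u \<in> ?Y" and pos: "D u > 0" for u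
    proof -
      have Yu: "V - S - insert u C = ?Y - {u}" and YV: "?Y \<subseteq> V" by auto
      have s: "slots E g S + (slots E g C + D u - 1) - 1 = ?s + D u - 1"
        using False pos by simp
      have "M \<le> 2 * (?s + D u - 1) + bigs (?Y - {u})"
        using bigs_step[OF YV u pos, of M ?s 0] inv by simp
      then have M: "M \<le> 2 * (slots (insert x E) (g(x := u)) S +
          slots (insert x E) (g(x := u)) (insert u C) - 1) + bigs (V - S - insert u C)"
        unfolding slots_upd_fresh[OF ex u pos] Yu s .
      show ?thesis
        using Suc.IH[OF explored_step[OF ex u pos] next_top M]
        unfolding slots_upd_fresh[OF ex u pos] s by (simp del: fun_upd_apply funpow.simps)
    qed
    have "real (card ?Y) * card {f\<in>ext E g. ?P f} \<le>
        (real ?s * 0 + (\<Sum>u\<in>?Y. D u * \<Phi> t (?s + D u - 1))) * card (ext E g)"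
      by (rule event_step[OF ex hit fresh])
    also have "\<dots> \<le> (real (card ?Y) * \<Phi> (Suc t) ?s) * card (ext E g)"
    proof (rule mult_right_mono)
      have "?s + (\<Sum>u\<in>?Y. D u) \<le> card V"
        unfolding Y[symmetric] using finite_V by (intro card_mono) auto
      then have "(\<Sum>u\<in>?Y. D u * \<Phi> t (?s + D u - 1)) \<le> real (?s + (\<Sum>u\<in>?Y. D u)) * \<Phi> (Suc t) ?s"
        using \<Phi>_Suc[of ?Y ?s t] inv by auto
      then show "real ?s * 0 + (\<Sum>u\<in>?Y. D u * \<Phi> t (?s + D u - 1)) \<le> real (card ?Y) * \<Phi> (Suc t) ?s"
        using Y by simp
    qed simp
    finally have le: "real (card ?Y) * card {f\<in>ext E g. ?P f} \<le>
        real (card ?Y) * (\<Phi> (Suc t) ?s * card (ext E g))" by (simp only: mult.assoc)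
    show ?thesis
    \<comment> \<open>Without unseen vertices the factor \<open>card ?Y\<close> cannot be cancelled,
      but then the next parent lies in \<open>S\<close> and the event is impossible.\<close>
    proof (cases "card ?Y = 0")
      case True
      have "(\<Sum>u\<in>S. card {f\<in>ext (insert x E) (g(x := u)). ?P f}) = 0"
        using hit by (intro sum.neutral) simp
      moreover have "?Y = {}" using True finite_V by simp
      ultimately have "card {f\<in>ext E g. ?P f} = 0"
        unfolding ext_split_explored[OF ex] by (simp only: sum.empty)
      then have zero: "real (card {f\<in>ext E g. ?P f}) = 0" by (simp only: of_nat_0)
      show ?thesis unfolding zero using \<Phi>_nonneg by simp
    next
      case False
      then show ?thesis using le by (simp add: mult_le_cancel_left)
    qed
  qed
qed

text \<open>The paths of the current leaf and of the leaves \<open>as\<close> are explored one after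
  the other, then that of \<open>l\<close>. The first index of \<Psi> counts the paths still to be
  closed before \<open>l\<close> starts: closing one lowers it and \<open>s\<close> by one, climbing
  only adds to \<open>s\<close>. What the walk from \<open>l\<close> contributes is isolated in
  \<open>base\<close>. \<open>T f\<close> stands for the subtree spanned by the explored leaves; it
  is only known to be closed under \<open>f\<close> and to contain what has been explored.\<close>

theorem stage_event:
  fixes \<Psi> :: "nat \<Rightarrow> nat \<Rightarrow> real" and M k :: nat and T :: "('a \<Rightarrow> 'a) \<Rightarrow> 'a set"
  assumes \<Psi>_Suc: "\<And>j s Y. Y \<subseteq> V \<Longrightarrow> Suc j \<le> k \<Longrightarrow>
      M + 2 * Suc j \<le> 2 * (s + k) + bigs Y \<Longrightarrow> s + (\<Sum>u\<in>Y. D u) \<le> card V \<Longrightarrow>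
      s * \<Psi> j (s - 1) + (\<Sum>u\<in>Y. D u * \<Psi> (Suc j) (s + D u - 1)) \<le> (s + (\<Sum>u\<in>Y. D u)) * \<Psi> (Suc j) s"
    and base: "\<And>E g S. explored E g S {l} l \<Longrightarrow>
      real (card {f\<in>ext E g. \<forall>i\<le>t. (f ^^ i) l \<notin> S}) \<le> \<Psi> 0 (slots E g S - 1) * card (ext E g)"
    and T: "\<And>f v. f \<in> trees \<Longrightarrow> v \<in> T f \<Longrightarrow> f v \<in> T f" "\<And>f. f \<in> trees \<Longrightarrow> set as \<subseteq> T f"
    and as: "distinct (l # as)" "\<And>a. a \<in> set (l # as) \<Longrightarrow> a \<in> V \<and> D a = 0"
    and "explored E g S C x" "\<And>f. f \<in> ext E g \<Longrightarrow> S \<union> C \<subseteq> T f"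
    and "set (l # as) \<inter> (S \<union> C) = {}"
    and "M + 2 * Suc (length as) \<le> 2 * (slots E g S + slots E g C - 1 + k) + bigs (V - S - C)"
    and "Suc (length as) \<le> k"
  shows "real (card {f\<in>ext E g. \<forall>i\<le>t. (f ^^ i) l \<notin> T f}) \<le>
    \<Psi> (Suc (length as)) (slots E g S + slots E g C - 1) * card (ext E g)"
  using assms(4-)
proof (induction "card (V - E)" arbitrary: as E g S C x rule: less_induct)
  case less
  note T_as = less.prems(1) and dist = less.prems(2) and leaf = less.prems(3) and ex = less.prems(4)
    and T_sub = less.prems(5) and fresh_as = less.prems(6) and inv = less.prems(7)
    and len = less.prems(8)
  note d = exploredD[OF ex] and e = ex[unfolded explored_def]
  let ?E = "insert x E" and ?g = "\<lambda>u. g(x := u)"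
  let ?Y = "V - S - C" and ?s = "slots E g S + slots E g C - 1"
  let ?P = "\<lambda>f. \<forall>i\<le>t. (f ^^ i) l \<notin> T f"
  let ?j = "length as"
  have dec: "card (V - ?E) < card (V - E)"
    using d(4,6) finite_V by (intro psubset_card_mono) auto
  have lY: "l \<in> ?Y" using fresh_as leaf by auto
  have sub: "ext ?E (?g u) \<subseteq> ext E g" for u using d(4) by (auto simp: ext_def split: if_splits)
  have hit: "real (card {f\<in>ext ?E (?g u). ?P f}) \<le> \<Psi> ?j (?s - 1) * card (ext ?E (?g u))"
    if u: "u \<in> S" and pos: "rem E g u > 0" for u
  proof -
    note st = explored_to_settled[OF ex u pos]
    have ex': "explored ?E (?g u) (S \<union> C) {y} y" if "y \<in> V - (S \<union> C)" for y
      using settled_explored[OF st that] unfolding d(7)[symmetric] .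
    have sl: "slots ?E (?g u) (S \<union> C) = ?s" by (rule slots_upd_hit[OF ex u pos])
    show ?thesis
    proof (cases as)
      \<comment> \<open>The last path has been closed, so the walk from \<open>l\<close> begins.
        Avoiding \<open>T f\<close> includes avoiding all that has been explored.\<close>
      case Nil
      have l: "l \<in> V - (S \<union> C)" using lY by auto
      have "real (card {f\<in>ext ?E (?g u). ?P f}) \<le>
          card {f\<in>ext ?E (?g u). \<forall>i\<le>t. (f ^^ i) l \<notin> S \<union> C}"
        using T_sub sub by (intro of_nat_mono card_mono) (simp, blast)
      also have "\<dots> \<le> \<Psi> 0 (?s - 1) * card (ext ?E (?g u))"
        using base[OF ex'[OF l]] unfolding sl .
      finally show ?thesis using Nil by simp
    next
      case (Cons a as')
      have a: "a \<in> V - (S \<union> C)" "a \<in> V" "D a = 0" using fresh_as leaf Cons by auto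
      have aY: "a \<in> ?Y" using a by auto
      \<comment> \<open>A leaf opens its path without any free slot, so the new value of
        \<open>s\<close> is the old one less one.\<close>
      have sa: "slots ?E (?g u) {a} = 0"
        using rem_fresh[OF ex aY] rem_upd[OF d(1,4), of g u a] a aY u by (auto simp: slots_def)
      have bigs: "bigs (V - (S \<union> C) - {a}) = bigs ?Y"
      proof -
        have "V - (S \<union> C) - {a} = ?Y - {a}" by auto
        moreover have "bigs ?Y = bigs (?Y - {a})"
          using bigs_remove[OF _ aY] finite_V a(3) by simp
        ultimately show ?thesis by simp
      qed
      have inv': "M + 2 * Suc (length as') \<le> 2 * (slots ?E (?g u) (S \<union> C) +
          slots ?E (?g u) {a} - 1 + k) + bigs (V - (S \<union> C) - {a})"
        unfolding sl sa bigs using inv Cons by simp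
      have "real (card {f\<in>ext ?E (?g u). ?P f}) \<le>
        \<Psi> (Suc (length as')) (slots ?E (?g u) (S \<union> C) + slots ?E (?g u) {a} - 1) * card (ext ?E (?g u))"
      proof (rule less.hyps[OF dec _ _ _ ex'[OF a(1)] _ _ inv' _])
        show "set as' \<subseteq> T f" if "f \<in> trees" for f using T_as[OF that] Cons by simp
        show "distinct (l # as')" using dist Cons by simp
        show "b \<in> V \<and> D b = 0" if "b \<in> set (l # as')" for b using leaf that Cons by auto
        show "S \<union> C \<union> {a} \<subseteq> T f" if "f \<in> ext ?E (?g u)" for f
        proof -
          have "f \<in> trees" using that by (simp add: ext_def)
          then have "a \<in> T f" using T_as[of f] Cons by auto
          then show ?thesis using T_sub[of f] sub[of u] that by blast
        qed
        show "Suc (length as') \<le> k" using len Cons by simp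
        show "set (l # as') \<inter> (S \<union> C \<union> {a}) = {}" using fresh_as dist Cons by auto
      qed
      then show ?thesis unfolding sl sa using Cons by simp
    qed
  qed
  have fresh: "real (card {f\<in>ext ?E (?g u). ?P f}) \<le>
      \<Psi> (Suc ?j) (?s + D u - 1) * card (ext ?E (?g u))" if u: "u \<in> ?Y" and pos: "D u > 0" for u
  proof (cases "slots E g S = 0")
    case True
    then show ?thesis using ext_empty_if_no_slots[OF ex] sub[of u] by simp
  next
    case False
    have Yu: "V - S - insert u C = ?Y - {u}" and YV: "?Y \<subseteq> V" by auto
    have s: "slots E g S + (slots E g C + D u - 1) - 1 = ?s + D u - 1"
      using False pos by simp
    have "M + 2 * Suc ?j \<le> 2 * (?s + D u - 1 + k) + bigs (?Y - {u})"
      by (rule bigs_step[OF YV u pos inv])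
    then have inv': "M + 2 * Suc ?j \<le> 2 * (slots ?E (?g u) S +
        slots ?E (?g u) (insert u C) - 1 + k) + bigs (V - S - insert u C)"
      unfolding slots_upd_fresh[OF ex u pos] Yu s .
    have "real (card {f\<in>ext ?E (?g u). ?P f}) \<le>
      \<Psi> (Suc ?j) (slots ?E (?g u) S + slots ?E (?g u) (insert u C) - 1) * card (ext ?E (?g u))"
    proof (rule less.hyps[OF dec T_as dist leaf explored_step[OF ex u pos] _ _ inv' _])
      show "S \<union> insert u C \<subseteq> T f" if f: "f \<in> ext ?E (?g u)" for f
      proof -
        have "f \<in> trees" "f x = u" using f by (auto simp: ext_def)
        moreover have "x \<in> T f" using T_sub[of f] sub f e by blast
        ultimately have "u \<in> T f" using T(1) by blast
        then show ?thesis using T_sub[of f] sub f by blast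
      qed
      show "Suc ?j \<le> k" by (rule len)
      \<comment> \<open>A new parent has a child, hence is none of the waiting leaves: they stay
        unseen until their turn.\<close>
      have "u \<notin> set (l # as)" using leaf[of u] pos by auto
      then show "set (l # as) \<inter> (S \<union> insert u C) = {}" using fresh_as by auto
    qed auto
    then show ?thesis unfolding slots_upd_fresh[OF ex u pos] s .
  qed
  show ?case
  proof (cases "slots E g S = 0")
    case True
    then show ?thesis using ext_empty_if_no_slots[OF ex] by simp
  next
    case False
    have Y: "card ?Y = ?s + (\<Sum>u\<in>?Y. D u)"
      using slots_total[OF ex] False by simp
    have "real (card ?Y) * card {f\<in>ext E g. ?P f} \<le>
        (real ?s * \<Psi> ?j (?s - 1) + (\<Sum>u\<in>?Y. D u * \<Psi> (Suc ?j) (?s + D u - 1))) * card (ext E g)"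
      by (rule event_step[OF ex hit fresh])
    also have "\<dots> \<le> (real (card ?Y) * \<Psi> (Suc ?j) ?s) * card (ext E g)"
    proof (rule mult_right_mono)
      have "?s + (\<Sum>u\<in>?Y. D u) \<le> card V"
        unfolding Y[symmetric] using finite_V by (intro card_mono) auto
      then show "real ?s * \<Psi> ?j (?s - 1) + (\<Sum>u\<in>?Y. D u * \<Psi> (Suc ?j) (?s + D u - 1))
          \<le> real (card ?Y) * \<Psi> (Suc ?j) ?s"
        unfolding Y using inv len by (intro \<Psi>_Suc) auto
    qed simp
    finally have "real (card ?Y) * card {f\<in>ext E g. ?P f} \<le>
        real (card ?Y) * (\<Psi> (Suc ?j) ?s * card (ext E g))" by (simp only: mult.assoc)
    moreover have "card ?Y > 0" using lY finite_V by (auto simp: card_gt_0_iff)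
    ultimately show ?thesis by (simp add: mult_le_cancel_left)
  qed
qed

end

subsection \<open>Depth of a leaf and length of a branch\<close>

lemma one_minus_exp_ge:
  fixes l :: real
  assumes "0 \<le> l" "l \<le> 1"
  shows "l / 2 \<le> 1 - exp (- l)"
proof -
  have "exp (- l) \<le> 1 / (1 + l)"
    using exp_ge_add_one_self[of l] assms by (simp add: exp_minus field_simps)
  also have "1 / (1 + l) \<le> 1 - l / 2"
  proof -
    have "l * l \<le> 1 * l" using assms by (intro mult_right_mono) auto
    then show ?thesis using assms by (simp add: field_simps)
  qed
  finally show ?thesis by simp
qed

text \<open>Turns a loss \<open>a\<close> out of \<open>b\<close> into a factor that does not depend
  on \<open>b\<close>, the number of unseen vertices, which varies along the exploration.\<close>

lemma diff_le_mult_exp: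
  fixes a b n :: real
  assumes "0 \<le> a" "0 \<le> b" "b \<le> n"
  shows "b - a \<le> b * exp (- (a / n))"
proof (cases "b = 0")
  case False
  then have b: "b > 0" using assms by simp
  have "1 - a / b \<le> exp (- (a / b))" using exp_ge_add_one_self[of "- (a / b)"] by simp
  also have "\<dots> \<le> exp (- (a / n))"
    using assms b by (simp add: frac_le)
  finally have "b * (1 - a / b) \<le> b * exp (- (a / n))" using b by (intro mult_left_mono) auto
  moreover have "b * (1 - a / b) = b - a" using b by (simp add: right_diff_distrib)
  ultimately show ?thesis by simp
qed (use assms in simp)

context rooted_degrees begin

lemma sum_weights:
  fixes h :: "nat \<Rightarrow> real"
  assumes "Y \<subseteq> V" "\<And>m. m \<ge> 2 \<Longrightarrow> h m \<le> q" "h 1 \<le> p"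
  shows "(\<Sum>u\<in>Y. D u * h (D u)) \<le> real ((\<Sum>u\<in>Y. D u) - bigs Y) * p + real (bigs Y) * q"
proof -
  have fin: "finite Y" using assms(1) finite_V by (rule finite_subset)
  have le: "bigs Y \<le> (\<Sum>u\<in>Y. D u)" by (rule bigs_le[OF fin])
  have "(\<Sum>u\<in>Y. D u * h (D u)) \<le>
      (\<Sum>u\<in>Y. real (D u - (if 2 \<le> D u then D u else 0)) * p + real (if 2 \<le> D u then D u else 0) * q)"
  proof (rule sum_mono)
    fix u assume "u \<in> Y"
    consider "D u = 0" | "D u = 1" | "D u \<ge> 2" by linarith
    then show "D u * h (D u) \<le> real (D u - (if 2 \<le> D u then D u else 0)) * p +
        real (if 2 \<le> D u then D u else 0) * q"
      by cases (use assms(2)[of "D u"] assms(3) in \<open>auto intro: mult_left_mono\<close>)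
  qed
  also have "\<dots> = real (\<Sum>u\<in>Y. D u - (if 2 \<le> D u then D u else 0)) * p + real (bigs Y) * q"
    unfolding bigs_def sum.distrib of_nat_sum sum_distrib_right by simp
  also have "(\<Sum>u\<in>Y. D u - (if 2 \<le> D u then D u else 0)) = (\<Sum>u\<in>Y. D u) - bigs Y"
    unfolding bigs_def by (intro sum_subtractf_nat) auto
  finally show ?thesis .
qed

text \<open>Climbing never lowers \<open>s\<close>, so each of the remaining \<open>t\<close> steps
  misses the \<open>s\<close> slots with probability at most \<open>exp (- s / n)\<close>.\<close>

lemma linear_potential_step:
  assumes "Y \<subseteq> V" "s + (\<Sum>u\<in>Y. D u) \<le> n"
  shows "(\<Sum>u\<in>Y. D u * exp (- (real t * real (s + D u - 1) / n))) \<le>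
    (s + (\<Sum>u\<in>Y. D u)) * exp (- (real (Suc t) * real s / n))"
proof -
  let ?W = "\<Sum>u\<in>Y. D u"
  have "(\<Sum>u\<in>Y. D u * exp (- (real t * real (s + D u - 1) / n))) \<le>
      (\<Sum>u\<in>Y. D u * exp (- (real t * real s / n)))"
  proof (rule sum_mono)
    fix u
    show "D u * exp (- (real t * real (s + D u - 1) / n)) \<le> D u * exp (- (real t * real s / n))"
      by (cases "D u = 0") (auto intro!: divide_right_mono mult_left_mono)
  qed
  also have "\<dots> = real ?W * exp (- (real t * real s / n))" by (simp add: sum_distrib_right)
  also have "\<dots> \<le> real (s + ?W) * exp (- (real s / n)) * exp (- (real t * real s / n))"
  proof (rule mult_right_mono)
    have "real (s + ?W) \<le> real n" using assms(2) by (rule of_nat_mono)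
    from diff_le_mult_exp[OF _ _ this, of "real s"]
    show "real ?W \<le> real (s + ?W) * exp (- (real s / n))" by (simp del: of_nat_sum)
  qed simp
  also have "\<dots> = (s + ?W) * exp (- (real (Suc t) * real s / n))"
    by (simp add: exp_add[symmetric] field_simps add_divide_distrib)
  finally show ?thesis .
qed

lemma ext_empty_set [simp]: "ext {} g = trees"
  by (simp add: ext_def)

lemma explored_init:
  assumes "l \<in> V"
  shows "explored {} g {r} {l} l"
  using settled_explored[of g "{r}" l] assms r_notin by (auto simp: settled_def)

lemma slots_init [simp]: "slots {} g S = (\<Sum>u\<in>S. D u)"
  by (simp add: slots_def rem_def)

lemma bigs_init:
  assumes "l \<in> V" "D l = 0"
  shows "bigs (V - {r} - {l}) = bigs V"
proof -
  have "V - {r} - {l} = V - {l}" using r_notin by auto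
  then show ?thesis using bigs_remove[OF finite_V assms(1)] assms(2) by simp
qed

lemma trees_nonempty:
  assumes "D r > 0"
  shows "trees \<noteq> {}"
proof (cases "V = {}")
  case True
  then show ?thesis using sum_D assms by simp
next
  case False
  then obtain l where "l \<in> V" by auto
  then show ?thesis
    using card_ext[OF explored_init, of l undefined] assms by auto
qed

lemma tree_root_absorbing:
  assumes "f \<in> trees" "(f ^^ i) v = r" "i \<le> j"
  shows "(f ^^ j) v = r"
proof -
  have fr: "f r = r" using assms(1) r_notin by (simp add: trees_def)
  have "(f ^^ m) r = r" for m by (induction m) (simp_all add: fr)
  moreover have "(f ^^ j) v = (f ^^ (j - i)) ((f ^^ i) v)"
    using assms(3) by (simp flip: funpow_add comp_apply[of "f ^^ _" "f ^^ _"])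
  ultimately show ?thesis using assms(2) by simp
qed

theorem single_leaf_depth:
  assumes "D r = 1" "l \<in> V" "D l = 0" "t2 \<le> card V"
  shows "real (card {f\<in>trees. (f ^^ (t1 + t2)) l \<noteq> r}) \<le>
    exp (- (real t1 * real t2 * real (bigs V) / (4 * (real (card V))^2))) * card trees"
proof -
  define n where "n = card V"
  have npos: "n > 0" using assms(2) finite_V unfolding n_def by (auto simp: card_gt_0_iff)
  define M where "M = bigs V"
  \<comment> \<open>With this value the two formulas of \<Phi> agree at \<open>t = t2\<close>;
    \<kappa> is the gain per step of the first phase.\<close>
  define lam where "lam = real t2 / n"
  define \<kappa> where "\<kappa> = lam * M / (4 * n)"
  have lam: "0 \<le> lam" "lam \<le> 1" using assms(4) npos by (auto simp: lam_def n_def)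
  \<comment> \<open>While more than \<open>t2\<close> steps remain, slots accumulate; the last \<open>t2\<close> steps have to avoid them.\<close>
  define \<Phi> :: "nat \<Rightarrow> nat \<Rightarrow> real" where
    "\<Phi> t s = (if t \<le> t2 then exp (- (real t * real s / n)) else exp (- (lam * s) - real (t - t2) * \<kappa>))" for t s
  have step: "(\<Sum>u\<in>Y. D u * \<Phi> t (s + D u - 1)) \<le> (s + (\<Sum>u\<in>Y. D u)) * \<Phi> (Suc t) s"
    if Y: "Y \<subseteq> V" "M \<le> 2 * s + bigs Y" "s + (\<Sum>u\<in>Y. D u) \<le> card V" for t s Y
  proof (cases "Suc t \<le> t2")
    case True
    then show ?thesis using linear_potential_step[OF Y(1,3)] by (simp add: \<Phi>_def n_def)
  next
    case False
    let ?W = "\<Sum>u\<in>Y. D u"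
    have fin: "finite Y" using Y(1) finite_V by (rule finite_subset)
    have bW: "bigs Y \<le> ?W" by (rule bigs_le[OF fin])
    have \<Phi>_t: "\<Phi> t s' = exp (- (lam * s') - real (t - t2) * \<kappa>)" for s'
      using False by (cases "t = t2") (auto simp: \<Phi>_def lam_def)
    define h where "h m = exp (- (lam * real (m - 1)))" for m
    have "(\<Sum>u\<in>Y. D u * h (D u)) \<le> real (?W - bigs Y) * 1 + real (bigs Y) * exp (- lam)"
    proof (rule sum_weights[OF Y(1)])
      show "h m \<le> exp (- lam)" if "m \<ge> 2" for m
        using that lam mult_left_mono[of 1 "real (m - 1)" lam] by (simp add: h_def)
    qed (simp add: h_def)
    also have "\<dots> = real (s + ?W) - (real s + real (bigs Y) * (1 - exp (- lam)))"
      using bW by (simp add: of_nat_diff algebra_simps)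
    also have "\<dots> \<le> real (s + ?W) - lam * M / 4"
    proof -
      \<comment> \<open>Either many slots are free and a hit is likely, or many slots belong to
        unseen vertices with at least two children and meeting one raises \<open>s\<close>. By the
        invariant the two gains together amount to \<open>lam * M / 4\<close> whatever the
        balance.\<close>
      have "lam * M / 4 \<le> lam * (2 * real s + 2 * real (bigs Y)) / 4"
        using Y(2) lam by (intro divide_right_mono mult_left_mono) auto
      also have "\<dots> = real s * (lam / 2) + real (bigs Y) * (lam / 2)" by (simp add: field_simps)
      also have "\<dots> \<le> real s * 1 + real (bigs Y) * (1 - exp (- lam))"
        using lam one_minus_exp_ge[OF lam] by (intro add_mono mult_left_mono) auto
      finally show ?thesis by simp
    qed
    also have "\<dots> \<le> real (s + ?W) * exp (- \<kappa>)"
    proof -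
      have "real (s + ?W) \<le> real n" unfolding n_def using Y(3) by (rule of_nat_mono)
      from diff_le_mult_exp[OF _ _ this, of "lam * M / 4"]
      show ?thesis using lam by (simp add: \<kappa>_def del: of_nat_sum of_nat_add)
    qed
    finally have key: "(\<Sum>u\<in>Y. D u * h (D u)) \<le> real (s + ?W) * exp (- \<kappa>)" .
    have "(\<Sum>u\<in>Y. D u * \<Phi> t (s + D u - 1)) =
        (\<Sum>u\<in>Y. D u * h (D u)) * exp (- (lam * s) - real (t - t2) * \<kappa>)"
      unfolding sum_distrib_right
    proof (rule sum.cong)
      fix u
      show "D u * \<Phi> t (s + D u - 1) = D u * h (D u) * exp (- (lam * s) - real (t - t2) * \<kappa>)"
      proof (cases "D u = 0")
        case False
        then have "\<Phi> t (s + D u - 1) = h (D u) * exp (- (lam * s) - real (t - t2) * \<kappa>)"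
          unfolding \<Phi>_t h_def exp_add[symmetric] by (simp add: of_nat_diff algebra_simps)
        then show ?thesis by simp
      qed simp
    qed simp
    also have "\<dots> \<le> real (s + ?W) * exp (- \<kappa>) * exp (- (lam * s) - real (t - t2) * \<kappa>)"
      by (rule mult_right_mono[OF key]) simp
    also have "\<dots> = real (s + ?W) * \<Phi> (Suc t) s"
    proof -
      have "Suc t - t2 = Suc (t - t2)" using False by simp
      then have "\<Phi> (Suc t) s = exp (- (lam * s) - real (Suc (t - t2)) * \<kappa>)"
        using False by (simp only: \<Phi>_def if_False)
      also have "\<dots> = exp (- \<kappa> + (- (lam * s) - real (t - t2) * \<kappa>))"
        by (rule arg_cong[where f = exp]) (simp add: algebra_simps)
      finally show ?thesis by (simp only: exp_add mult.assoc)
    qed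
    finally show ?thesis .
  qed
  have "real (card {f\<in>ext {} undefined. \<forall>i\<le>0 + (t1 + t2). (f ^^ i) l \<notin> {r}}) \<le>
      \<Phi> (t1 + t2) (slots {} undefined {r} + slots {} undefined {l} - 1) * card (ext {} undefined)"
  proof (rule path_event[where M = M])
    show "explored {} undefined {r} {l} l" by (rule explored_init[OF assms(2)])
    show "M \<le> 2 * (slots {} undefined {r} + slots {} undefined {l} - 1) + bigs (V - {r} - {l})"
      unfolding bigs_init[OF assms(2,3)] by (simp add: M_def)
    show "(\<Sum>u\<in>Y. D u * \<Phi> t (s + D u - 1)) \<le> (s + (\<Sum>u\<in>Y. D u)) * \<Phi> (Suc t) s"
      if "Y \<subseteq> V" "M \<le> 2 * s + bigs Y" "s + (\<Sum>u\<in>Y. D u) \<le> card V" for t s Y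
      by (rule step[OF that])
    show "(f ^^ 0) l = l" for f :: "'a \<Rightarrow> 'a" by simp
    show "0 \<le> \<Phi> t s" "1 \<le> \<Phi> 0 s" for t s
      unfolding \<Phi>_def by auto
  qed
  moreover have "{f\<in>ext {} undefined. \<forall>i\<le>0 + (t1 + t2). (f ^^ i) l \<notin> {r}} = {f\<in>trees. (f ^^ (t1 + t2)) l \<noteq> r}"
  proof -
    have "(\<forall>i\<le>0 + (t1 + t2). (f ^^ i) l \<notin> {r}) \<longleftrightarrow> (f ^^ (t1 + t2)) l \<noteq> r" if "f \<in> trees" for f
      using tree_root_absorbing[OF that] by (metis add_0 order_refl singletonD singletonI)
    then show ?thesis unfolding ext_empty_set by (intro Collect_cong conj_cong) simp_all
  qed
  moreover have "\<Phi> (t1 + t2) (slots {} undefined {r} + slots {} undefined {l} - 1) =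
      exp (- (real t1 * real t2 * real (bigs V) / (4 * (real (card V))^2)))"
    using assms(1,3) by (cases "t1 = 0") (auto simp: \<Phi>_def \<kappa>_def lam_def M_def n_def power2_eq_square)
  ultimately show ?thesis by simp
qed

section \<open>Distance of a leaf to the subtree spanned by other leaves\<close>

definition spanned :: "'a set \<Rightarrow> ('a \<Rightarrow> 'a) \<Rightarrow> 'a set" where
  "spanned A f = insert r {v. \<exists>a\<in>A. (a, v) \<in> (steps_on V f)\<^sup>*}"

lemma spanned_closed:
  assumes "f \<in> trees" "v \<in> spanned A f"
  shows "f v \<in> spanned A f"
proof (cases "v \<in> V")
  case True
  then have "v \<noteq> r" using r_notin by blast
  then obtain a where "a \<in> A" "(a, v) \<in> (steps_on V f)\<^sup>*"
    using assms(2) by (auto simp: spanned_def)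
  then show ?thesis using steps_on_rtrancl_step[OF _ True] by (auto simp: spanned_def)
next
  case False
  then show ?thesis using assms(1) by (simp add: spanned_def trees_def)
qed

text \<open>Two ways to fail: the \<open>k\<close> paths leave fewer slots than the target
  \<open>u - k\<close>, which an exponential potential with tilt \<open>lam\<close> and factor
  \<open>w\<close> per path bounds by the first term, or the walk from \<open>l\<close> misses at
  least \<open>u - k\<close> slots for \<open>t\<close> steps, the second term. The condition on
  \<open>w\<close> is what the one-step inequality requires.\<close>

theorem branch_length_general:
  fixes u lam w :: real
  assumes "D r = 1" and l: "l \<in> V" "D l = 0" "l \<notin> A" and A: "A \<subseteq> V" "\<And>a. a \<in> A \<Longrightarrow> D a = 0" "card A = k" "k \<ge> 1"
    and lam: "0 < lam" "lam \<le> 1" and w: "4 * u * exp lam \<le> w * lam * bigs V" "0 < w"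
    and u: "0 < u" "4 * u \<le> bigs V"
  shows "real (card {f\<in>trees. \<forall>i\<le>t. (f ^^ i) l \<notin> spanned A f}) \<le>
    (w ^ k * exp (lam * (u - k)) + exp (- (real t * (u - k) / card V))) * card trees"
proof -
  define n where "n = card V"
  define M where "M = bigs V"
  define \<epsilon> where "\<epsilon> = exp (- (real t * (u - k) / n))"
  define U where "U j s = real s + real k - real j" for j s :: nat
  \<comment> \<open>\<open>U j s\<close> is nondecreasing, and once it has reached \<open>u\<close> at least \<open>u - k\<close> slots remain at the end.\<close>
  define A' where "A' j s = (if U j s < u then w ^ j * exp (lam * (u - k - s)) else 0)" for j s :: nat
  define \<Psi> where "\<Psi> j s = A' j s + \<epsilon>" for j s :: nat
  have step: "s * \<Psi> j (s - 1) + (\<Sum>v\<in>Y. D v * \<Psi> (Suc j) (s + D v - 1)) \<le> (s + (\<Sum>v\<in>Y. D v)) * \<Psi> (Suc j) s"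
    if Y: "Y \<subseteq> V" "Suc j \<le> k" "M + 2 * Suc j \<le> 2 * (s + k) + bigs Y" for j s Y
  proof -
    let ?W = "\<Sum>v\<in>Y. D v"
    have "s * A' j (s - 1) + (\<Sum>v\<in>Y. D v * A' (Suc j) (s + D v - 1)) \<le> (s + ?W) * A' (Suc j) s"
    proof (cases "U (Suc j) s < u")
      case False
      have "s * A' j (s - 1) = 0"
        using False by (cases s) (auto simp: A'_def U_def)
      moreover have "D v * A' (Suc j) (s + D v - 1) = 0" for v
        using False by (cases "D v") (auto simp: A'_def U_def)
      ultimately have "s * A' j (s - 1) + (\<Sum>v\<in>Y. D v * A' (Suc j) (s + D v - 1)) = 0"
        by (simp only: sum.neutral_const add_0)
      then show ?thesis using False by (simp add: A'_def)
    next
      case True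
      define c where "c = w ^ j * exp (lam * (u - k - s))"
      have c: "c > 0" using w(2) by (simp add: c_def)
      have fin: "finite Y" using Y(1) finite_V by (rule finite_subset)
      have bW: "bigs Y \<le> ?W" by (rule bigs_le[OF fin])
      have hit: "s * A' j (s - 1) \<le> c * (s * exp lam)"
      proof (cases s)
        case (Suc s')
        have "A' j (s - 1) \<le> c * exp lam"
          using Suc w(2) by (simp add: A'_def c_def mult.assoc exp_add[symmetric] algebra_simps)
        then have "s * A' j (s - 1) \<le> s * (c * exp lam)" by (intro mult_left_mono) auto
        then show ?thesis by (simp add: mult.left_commute)
      qed simp
      define h where "h m = exp (- (lam * real (m - 1)))" for m
      have "(\<Sum>v\<in>Y. D v * A' (Suc j) (s + D v - 1)) \<le> (\<Sum>v\<in>Y. c * w * (D v * h (D v)))"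
      proof (rule sum_mono)
        fix v
        show "D v * A' (Suc j) (s + D v - 1) \<le> c * w * (D v * h (D v))"
        proof (cases "D v = 0")
          case False
          then have "A' (Suc j) (s + D v - 1) \<le> c * w * h (D v)"
            using w(2) by (simp add: A'_def c_def h_def mult.assoc mult.left_commute exp_add[symmetric] of_nat_diff algebra_simps)
          then have "D v * A' (Suc j) (s + D v - 1) \<le> D v * (c * w * h (D v))"
            by (intro mult_left_mono) auto
          then show ?thesis by (simp add: mult.left_commute)
        qed simp
      qed
      also have "\<dots> = c * w * (\<Sum>v\<in>Y. D v * h (D v))" by (simp add: sum_distrib_left)
      also have "\<dots> \<le> c * w * (real (?W - bigs Y) * 1 + real (bigs Y) * exp (- lam))"
      proof (intro mult_left_mono sum_weights[OF Y(1)])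
        show "h m \<le> exp (- lam)" if "m \<ge> 2" for m
          using that lam mult_left_mono[of 1 "real (m - 1)" lam] by (simp add: h_def)
      qed (use c w in \<open>auto simp: h_def\<close>)
      also have "\<dots> = c * (w * (?W - real (bigs Y) * (1 - exp (- lam))))"
        using bW by (simp add: of_nat_diff algebra_simps)
      finally have fresh: "(\<Sum>v\<in>Y. D v * A' (Suc j) (s + D v - 1)) \<le>
          c * (w * (?W - real (bigs Y) * (1 - exp (- lam))))" .
      \<comment> \<open>Closing a path lowers \<open>s\<close> and so costs a factor
        \<open>exp lam\<close>, but frees a factor \<open>w\<close>. Below the target at most
        \<open>u\<close> slots can be hit, and their cost is paid by the gain from the unseen
        vertices counted in \<open>bigs Y\<close>.\<close>
      have "s * exp lam \<le> u * exp lam"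
        using True Y(2) by (intro mult_right_mono) (auto simp: U_def)
      also have "\<dots> \<le> w * (M / 2 * (lam / 2))" using w(1) by (simp add: M_def field_simps)
      also have "\<dots> \<le> w * (real (bigs Y) * (1 - exp (- lam)))"
      proof (intro mult_left_mono mult_mono)
        \<comment> \<open>The invariant says \<open>M <= 2 * U (Suc j) s + bigs Y\<close>. Since
          \<open>U\<close> is below \<open>u\<close>, which is at most a quarter of
          \<open>M\<close>, at least half of \<open>M\<close> is still unseen.\<close>
        have "real M + 2 * real (Suc j) \<le> 2 * (real s + real k) + real (bigs Y)"
          using Y(3) by (metis of_nat_add of_nat_le_iff of_nat_mult of_nat_numeral)
        then show "M / 2 \<le> real (bigs Y)" using True u(2) by (simp add: U_def M_def)
      qed (use lam w one_minus_exp_ge[of lam] in auto)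
      also have "\<dots> \<le> w * (s + real (bigs Y) * (1 - exp (- lam)))" using w(2) by simp
      finally have "c * (s * exp lam) \<le> c * (w * (s + real (bigs Y) * (1 - exp (- lam))))"
        using c by (intro mult_left_mono) auto
      with hit fresh have "s * A' j (s - 1) + (\<Sum>v\<in>Y. D v * A' (Suc j) (s + D v - 1)) \<le>
          c * (w * (s + real (bigs Y) * (1 - exp (- lam)))) + c * (w * (?W - real (bigs Y) * (1 - exp (- lam))))"
        by linarith
      also have "\<dots> = (s + ?W) * (c * w)" by (simp add: algebra_simps)
      also have "c * w = A' (Suc j) s" using True by (simp add: A'_def c_def)
      finally show ?thesis .
    qed
    then show ?thesis
      by (simp add: \<Psi>_def sum.distrib sum_distrib_right distrib_left distrib_right)
  qed
  have base: "real (card {f\<in>ext E g. \<forall>i\<le>t. (f ^^ i) l \<notin> S}) \<le> \<Psi> 0 (slots E g S - 1) * card (ext E g)"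
    if ex: "explored E g S {l} l" for E g S
  proof -
    let ?s = "slots E g S - 1"
    have "slots E g {l} = 0" using l(2) by (simp add: slots_def rem_def)
    then have "real (card {f\<in>ext E g. \<forall>i\<le>0 + t. (f ^^ i) l \<notin> S}) \<le> exp (- (real t * real ?s / n)) * card (ext E g)"
      using path_event[where M = 0 and \<Phi> = "\<lambda>t s. exp (- (real t * real s / n))" and c = 0 and l = l and t = t,
        OF _ _ _ ex] linear_potential_step by (simp add: n_def)
    also have "\<dots> \<le> \<Psi> 0 ?s * card (ext E g)"
    proof (rule mult_right_mono)
      show "exp (- (real t * real ?s / n)) \<le> \<Psi> 0 ?s"
      proof (cases "U 0 ?s < u")
        case True
        then have "1 \<le> exp (lam * (u - k - ?s))" using lam by (simp add: U_def)
        moreover have "exp (- (real t * real ?s / n)) \<le> 1" by simp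
        moreover have "0 \<le> \<epsilon>" by (simp add: \<epsilon>_def)
        ultimately have "exp (- (real t * real ?s / n)) \<le> exp (lam * (u - k - ?s)) + \<epsilon>"
          by linarith
        then show ?thesis using True by (simp add: \<Psi>_def A'_def)
      next
        case False
        then have "real t * (u - k) / n \<le> real t * real ?s / n"
          by (intro divide_right_mono mult_left_mono) (auto simp: U_def)
        then show ?thesis using False by (simp add: \<Psi>_def A'_def \<epsilon>_def)
      qed
    qed simp
    finally show ?thesis by simp
  qed
  have "finite A" using A(1) finite_V by (rule finite_subset)
  then obtain as' where as': "set as' = A" "distinct as'" using finite_distinct_list by blast
  have "length as' = k" using as' A(3) distinct_card by fastforce
  then obtain a as where as: "as' = a # as" using A(4) by (cases as') auto
  have len: "Suc (length as) = k" using \<open>length as' = k\<close> as by simp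
  have a: "a \<in> A" "a \<in> V" "D a = 0" using as' as A by auto
  have "real (card {f\<in>ext {} undefined. \<forall>i\<le>t. (f ^^ i) l \<notin> spanned A f}) \<le>
    \<Psi> (Suc (length as)) (slots {} undefined {r} + slots {} undefined {a} - 1) * card (ext {} undefined)"
  proof (rule stage_event[where M = M and k = k])
    show "real s * \<Psi> j (s - 1) + (\<Sum>u\<in>Y. real (D u) * \<Psi> (Suc j) (s + D u - 1)) \<le> real (s + sum D Y) * \<Psi> (Suc j) s"
      if "Y \<subseteq> V" "Suc j \<le> k" "M + 2 * Suc j \<le> 2 * (s + k) + bigs Y" for j s Y
      using step[OF that] by simp
    show "set as \<subseteq> spanned A f" for f
      using as' as by (auto simp: spanned_def)
    show "distinct (l # as)" using as' as l(3) by auto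
    show "b \<in> V \<and> D b = 0" if "b \<in> set (l # as)" for b using as' as l A that by auto
    show "explored {} undefined {r} {a} a" by (rule explored_init[OF a(2)])
    show "{r} \<union> {a} \<subseteq> spanned A f" for f using a(1) by (auto simp: spanned_def)
    show "set (l # as) \<inter> ({r} \<union> {a}) = {}" using as' as l A r_notin by auto
    show "M + 2 * Suc (length as) \<le> 2 * (slots {} undefined {r} + slots {} undefined {a} - 1 + k) + bigs (V - {r} - {a})"
      unfolding bigs_init[OF a(2,3)] len by (simp add: M_def)
  qed (use base spanned_closed len in auto)
  moreover have "\<Psi> (Suc (length as)) (slots {} undefined {r} + slots {} undefined {a} - 1) =
      w ^ k * exp (lam * (u - k)) + exp (- (real t * (u - k) / card V))"
    unfolding len using assms(1) a(3) u(1) by (simp add: \<Psi>_def A'_def U_def \<epsilon>_def n_def)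
  ultimately show ?thesis by simp
qed

text \<open>Heuristically m steps collect about m M / n slots and make about m^2 M / n^2 hits, so k
  hits come with about sqrt (k M) slots. The target \<open>u\<close> is a fixed fraction of
  that.\<close>

theorem branch_length:
  assumes "D r = 1" and l: "l \<in> V" "D l = 0" "l \<notin> A" and A: "A \<subseteq> V" "\<And>a. a \<in> A \<Longrightarrow> D a = 0" "card A = k"
    and k: "k \<ge> 1" "256 * k \<le> bigs V"
  shows "real (card {f\<in>trees. \<forall>i\<le>t. (f ^^ i) l \<notin> spanned A f}) \<le>
    ((1/2) ^ k + exp (- (real t * sqrt (real k * bigs V) / (16 * card V)))) * card trees"
proof -
  define M where "M = real (bigs V)"
  define q where "q = sqrt (real k * M)"
  have M: "256 * real k \<le> M" "M > 0" using k by (auto simp: M_def)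
  have q2: "q * q = real k * M" using M by (simp add: q_def)
  have qpos: "q > 0" using k(1) M by (simp add: q_def)
  have qk: "16 * real k \<le> q"
  proof -
    have "(16 * real k)^2 = real k * (256 * real k)" by (simp add: power2_eq_square)
    also have "\<dots> \<le> real k * M" using M by (intro mult_left_mono) auto
    finally show ?thesis unfolding q_def by (rule real_le_rsqrt)
  qed
  have qM: "16 * q \<le> M"
  proof -
    have "q * (16 * real k) \<le> q * q" using qk qpos by (intro mult_left_mono) auto
    have "(16 * q) * real k \<le> M * real k" using \<open>q * (16 * real k) \<le> q * q\<close> q2 by (simp add: ac_simps)
    then show ?thesis using k(1) by simp
  qed
  \<comment> \<open>\<open>lam\<close> is chosen so that \<open>lam * u = k\<close>, and
    \<open>w\<close> so that the condition of \<open>branch_length_general\<close> holds with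
    equality. The first failure term then equals (e / 16)^k. Since \<open>256 * k <= M\<close> gives
    \<open>16 * k <= q\<close>, the target exceeds \<open>k\<close> by at least
    \<open>q / 16\<close>.\<close>
  define u where "u = q / 8"
  define lam where "lam = real k / u"
  define w where "w = exp lam / 16"
  have u: "0 < u" "4 * u \<le> real (bigs V)" using qpos qM by (auto simp: u_def M_def)
  have lam: "0 < lam" "lam \<le> 1" using u(1) k(1) qk by (auto simp: lam_def u_def)
  have lu: "lam * u = k" using u(1) by (simp add: lam_def)
  have "4 * u * exp lam \<le> w * lam * M"
  proof -
    have "lam * M * u = 64 * (u * u)" using lu q2 by (simp add: u_def algebra_simps)
    then have "lam * M = 64 * u" using u(1) by simp
    then show ?thesis by (simp add: w_def mult.assoc)
  qed
  then have w: "4 * u * exp lam \<le> w * lam * real (bigs V)" "0 < w" by (auto simp: M_def w_def)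
  have "w ^ k * exp (lam * (u - k)) \<le> (1/2) ^ k"
  proof -
    have "w ^ k * exp (lam * (u - k)) = (exp lam)^k * exp (lam * u - lam * k) / 16 ^ k"
      by (simp add: w_def power_divide algebra_simps)
    also have "(exp lam)^k * exp (lam * u - lam * k) = exp 1 ^ k"
      unfolding lu exp_of_nat_mult[symmetric] exp_add[symmetric] by (simp add: algebra_simps)
    also have "exp 1 ^ k / 16 ^ k = (exp 1 / 16 :: real) ^ k" by (simp add: power_divide)
    also have "\<dots> \<le> (1/2) ^ k"
      using exp_le by (intro power_mono) auto
    finally show ?thesis by simp
  qed
  moreover have "exp (- (real t * (u - k) / card V)) \<le> exp (- (real t * q / (16 * card V)))"
  proof -
    have "q / 16 \<le> u - k" using qk by (simp add: u_def)
    then have "real t * (q / 16) / card V \<le> real t * (u - k) / card V"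
      by (intro divide_right_mono mult_left_mono) auto
    then show ?thesis by simp
  qed
  ultimately have "(w ^ k * exp (lam * (u - k)) + exp (- (real t * (u - k) / card V))) * card trees \<le>
      ((1/2) ^ k + exp (- (real t * q / (16 * card V)))) * card trees"
    by (intro mult_right_mono add_mono) auto
  then show ?thesis
    using branch_length_general[OF assms(1) l A k(1) lam w u, of t] by (simp add: q_def M_def)
qed

end

subsection \<open>Chaining over the leaves\<close>

lemma geometric_sum_le:
  fixes q :: real
  assumes "0 \<le> q" "q < 1"
  shows "(\<Sum>i<J. q ^ i) \<le> 1 / (1 - q)"
  using assms by (simp add: sum_gp_strict divide_right_mono)

lemma card_bex_le:
  fixes p :: "'b \<Rightarrow> real"
  assumes "finite I" "finite X" "\<And>i. i \<in> I \<Longrightarrow> real (card {f\<in>X. P i f}) \<le> p i"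
  shows "real (card {f\<in>X. \<exists>i\<in>I. P i f}) \<le> (\<Sum>i\<in>I. p i)"
proof -
  have "{f\<in>X. \<exists>i\<in>I. P i f} = (\<Union>i\<in>I. {f\<in>X. P i f})" by auto
  then have "card {f\<in>X. \<exists>i\<in>I. P i f} \<le> (\<Sum>i\<in>I. card {f\<in>X. P i f})"
    using card_UN_le[OF assms(1), of "\<lambda>i. {f\<in>X. P i f}"] by (simp only:)
  then have "real (card {f\<in>X. \<exists>i\<in>I. P i f}) \<le> (\<Sum>i\<in>I. real (card {f\<in>X. P i f}))"
    unfolding of_nat_sum[symmetric] by (rule of_nat_mono)
  also have "\<dots> \<le> (\<Sum>i\<in>I. p i)" using assms(3) by (intro sum_mono)
  finally show ?thesis .
qed

context rooted_degrees begin

lemma spanned_depth: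
  assumes f: "f \<in> trees" and A: "\<And>a. a \<in> A \<Longrightarrow> (f ^^ h) a = r" and v: "v \<in> spanned A f"
  shows "(f ^^ h) v = r"
proof (cases "v = r")
  case True
  then show ?thesis using tree_root_absorbing[OF f, of 0 v h] by simp
next
  case False
  then obtain a where a: "a \<in> A" "(a, v) \<in> (steps_on V f)\<^sup>*" using v by (auto simp: spanned_def)
  obtain j where "v = (f ^^ j) a" using steps_on_rtrancl_funpow[OF a(2)] by blast
  then have "(f ^^ h) v = (f ^^ (h + j)) a" by (simp add: funpow_add)
  also have "\<dots> = r" by (rule tree_root_absorbing[OF f A[OF a(1)]]) simp
  finally show ?thesis .
qed

text \<open>A vertex of the subtree spanned by \<open>A i\<close> is no deeper than the deepest leaf
  of \<open>A i\<close>, and a new leaf reaches that subtree within \<open>t i\<close> steps; so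
  each level adds \<open>t i\<close>.\<close>

lemma chain_depth:
  assumes f: "f \<in> trees" and A0: "\<And>a. a \<in> A 0 \<Longrightarrow> (f ^^ h) a = r"
    and step: "\<And>i l. i < J \<Longrightarrow> l \<in> A (Suc i) - A i \<Longrightarrow> \<exists>i'\<le>t i. (f ^^ i') l \<in> spanned (A i) f"
    and "i \<le> J" "a \<in> A i"
  shows "(f ^^ (h + (\<Sum>j<i. t j))) a = r"
  using assms(4,5)
proof (induction i arbitrary: a)
  case 0
  then show ?case using A0 by simp
next
  case (Suc i)
  let ?h = "h + (\<Sum>j<i. t j)"
  have IH: "(f ^^ ?h) b = r" if "b \<in> A i" for b
    using Suc.IH Suc.prems(1) that by simp
  show ?case
  proof (cases "a \<in> A i")
    case True
    show ?thesis by (rule tree_root_absorbing[OF f IH[OF True]]) simp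
  next
    case False
    then obtain i' where i': "i' \<le> t i" "(f ^^ i') a \<in> spanned (A i) f"
      using step[of i a] Suc.prems by auto
    have "(f ^^ (?h + i')) a = r"
      using spanned_depth[OF f IH i'(2)] by (simp add: funpow_add)
    then show ?thesis by (rule tree_root_absorbing[OF f]) (use i'(1) in simp)
  qed
qed

theorem height_tail:
  fixes H :: nat and z :: real
  assumes D_root: "D r = 1" and leaves: "card {l\<in>V. D l = 0} \<le> 2 * bigs V" and H: "H \<le> card V"
    and z: "z = real (bigs V) * (real H)^2 / (real (card V))^2" "z \<ge> 4000"
  shows "real (card {f\<in>trees. \<exists>l\<in>V. D l = 0 \<and> (f ^^ H) l \<noteq> r}) \<le> 150000 * z * exp (- (z / 100)) * card trees"
proof -
  define n where "n = real (card V)"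
  define M where "M = real (bigs V)"
  define h where "h = real H"
  define L where "L = {l\<in>V. D l = 0}"
  have zd: "z = M * h^2 / n^2" using z(1) by (simp add: M_def h_def n_def)
  have "n \<noteq> 0" using z(2) zd by auto
  then have n: "n > 0" by (simp add: n_def)
  have "M \<noteq> 0" using z(2) zd by auto
  then have M: "M > 0" by (simp add: M_def)
  have Mn: "M \<le> n"
  proof -
    have "bigs V \<le> (\<Sum>v\<in>V. D v)" by (rule bigs_le[OF finite_V])
    also have "\<dots> \<le> card V" using sum_D finite_V r_notin by simp
    finally show ?thesis by (simp add: M_def n_def)
  qed
  have zn: "z * n^2 = M * h^2" using zd n by simp
  have hn: "4000 * n \<le> h^2"
  proof -
    have "M * (4000 * n) \<le> n * (4000 * n)" using Mn n by (intro mult_right_mono) auto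
    also have "\<dots> \<le> z * n^2" using z(2) n by (simp add: power2_eq_square)
    finally show ?thesis using M zn by simp
  qed
  have n1: "n \<ge> 1" using n by (simp add: n_def)
  have "(20::real)^2 \<le> h^2" using hn n1 by simp
  then have h20: "h \<ge> 20" using power2_le_imp_le[of 20 h] by (simp add: h_def)
  \<comment> \<open>With \<open>16 * z\<close> leaves at the start the exponent obtained for level
    \<open>i\<close> in \<open>p2\<close> is \<open>(3/2) ^ i * z / 64\<close>, which beats
    \<open>z / 100\<close>; the other term \<open>(1/2) ^ kk i\<close> is small enough as
    well.\<close>
  define k0 where "k0 = nat \<lceil>16 * z\<rceil>"
  have k0: "16 * z \<le> k0" "k0 \<le> 17 * z" "k0 \<ge> 1"
    using z(2) by (auto simp: k0_def) linarith+
  define kk where "kk i = 4 ^ i * k0" for i :: nat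
  \<comment> \<open>The first level to which \<open>branch_length\<close> no longer applies. There
    the leaves, at most \<open>2 * bigs V\<close>, number less than \<open>512 * kk J\<close>, so
    all the rest can be added in a single last level.\<close>
  define J where "J = (LEAST J. bigs V < 256 * kk J)"
  have ex: "\<exists>J. bigs V < 256 * kk J"
  proof -
    have "bigs V < 2 ^ bigs V" by (rule less_exp)
    also have "\<dots> \<le> 4 ^ bigs V" by (rule power_mono) auto
    also have "\<dots> \<le> 256 * kk (bigs V)" using k0(3) by (simp add: kk_def)
    finally show ?thesis by blast
  qed
  have J0: "bigs V < 256 * kk J" unfolding J_def by (rule LeastI_ex[OF ex])
  have J: "256 * kk i \<le> bigs V" if "i < J" for i
    using not_less_Least[of i "\<lambda>J. bigs V < 256 * kk J"] that
    unfolding J_def by (simp add: not_less)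
  have finL: "finite L" using finite_V by (simp add: L_def)
  then obtain ls where ls: "set ls = L" "distinct ls" using finite_distinct_list by blast
  \<comment> \<open>Prefixes of one fixed list of the leaves. If the list is shorter than
    \<open>kk i\<close>, level \<open>i\<close> already contains every leaf and there is no new one
    to treat; hence the hypothesis \<open>l \<in> L - A i\<close> of \<open>cardA'\<close>.\<close>
  define A where "A i = (if i < J then set (take (kk i) ls) else L)" for i
  have AL: "A i \<subseteq> L" for i using ls(1) set_take_subset[of "kk i" ls] by (simp add: A_def)
  have cardA: "card (A i) \<le> 512 * kk i" if "i \<le> J" for i
  proof (cases "i < J")
    case True
    have "card (set (take (kk i) ls)) \<le> kk i"
      using card_length[of "take (kk i) ls"] by simp
    then show ?thesis using True by (simp add: A_def)
  next
    case False
    then have "card (A i) \<le> 2 * bigs V" "i = J" using leaves that by (auto simp: A_def L_def)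
    then show ?thesis using J0 by simp
  qed
  have cardA': "card (A i) = kk i" if "i < J" "l \<in> L - A i" for i l
  proof -
    have "kk i < length ls"
    proof (rule ccontr)
      assume "\<not> kk i < length ls"
      then have "take (kk i) ls = ls" by simp
      then show False using that ls(1) by (simp add: A_def)
    qed
    then show ?thesis using that(1) ls(2) by (simp add: A_def distinct_card)
  qed
  \<comment> \<open>Both phases of \<open>single_leaf_depth\<close> get \<tau> steps, which uses up
    at most half of \<open>H\<close>; the other half is the sum of the \<open>t i\<close>.\<close>
  define \<tau> where "\<tau> = H div 4"
  define t where "t i = nat \<lfloor>h / 8 * (3/4) ^ i\<rfloor>" for i :: nat
  let ?T = "real (card trees)"
  let ?start = "\<lambda>f. \<exists>a\<in>A 0. (f ^^ (\<tau> + \<tau>)) a \<noteq> r"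
  let ?bad = "\<lambda>i f. \<exists>l\<in>A (Suc i) - A i. \<forall>i'\<le>t i. (f ^^ i') l \<notin> spanned (A i) f"
  have tot: "\<tau> + \<tau> + (\<Sum>i<J. t i) \<le> H"
  proof -
    have "real (\<Sum>i<J. t i) \<le> (\<Sum>i<J. h / 8 * (3/4) ^ i)"
      unfolding of_nat_sum t_def using h20 by (intro sum_mono of_nat_floor) auto
    also have "\<dots> = h / 8 * (\<Sum>i<J. (3/4) ^ i)" by (simp add: sum_distrib_left)
    also have "\<dots> \<le> h / 8 * (1 / (1 - 3/4))"
      using h20 by (intro mult_left_mono geometric_sum_le) auto
    finally have "real (\<Sum>i<J. t i) \<le> h / 2" by simp
    moreover have "real \<tau> \<le> h / 4" unfolding \<tau>_def h_def by linarith
    ultimately have "real (\<tau> + \<tau> + (\<Sum>i<J. t i)) \<le> real H" by (simp add: h_def)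
    then show ?thesis by (simp only: of_nat_le_iff)
  qed
  have sub: "{f\<in>trees. \<exists>l\<in>V. D l = 0 \<and> (f ^^ H) l \<noteq> r} \<subseteq>
      {f\<in>trees. ?start f} \<union> {f\<in>trees. \<exists>i\<in>{..<J}. ?bad i f}"
  proof
    fix f assume f: "f \<in> {f\<in>trees. \<exists>l\<in>V. D l = 0 \<and> (f ^^ H) l \<noteq> r}"
    then obtain l where l: "f \<in> trees" "l \<in> L" "(f ^^ H) l \<noteq> r" by (auto simp: L_def)
    show "f \<in> {f\<in>trees. ?start f} \<union> {f\<in>trees. \<exists>i\<in>{..<J}. ?bad i f}"
    proof (rule ccontr)
      assume "\<not> ?thesis"
      then have neg: "\<not> ?start f" "\<not> (\<exists>i\<in>{..<J}. ?bad i f)"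
        using l(1) by blast+
      have "(f ^^ (\<tau> + \<tau> + (\<Sum>i<J. t i))) l = r"
      proof (rule chain_depth[OF l(1), where A = A and J = J])
        show "(f ^^ (\<tau> + \<tau>)) a = r" if "a \<in> A 0" for a using neg(1) that by blast
        show "\<exists>i'\<le>t i. (f ^^ i') l \<in> spanned (A i) f" if "i < J" "l \<in> A (Suc i) - A i" for i l
          using neg(2) that by blast
        show "l \<in> A J" using l(2) by (simp add: A_def)
      qed simp
      from tree_root_absorbing[OF l(1) this tot] l(3) show False by simp
    qed
  qed
  have b0: "real (card {f\<in>trees. ?start f}) \<le> 512 * k0 * exp (- (z / 100)) * ?T"
  proof -
    have "real (card {f\<in>trees. (f ^^ (\<tau> + \<tau>)) a \<noteq> r}) \<le> exp (- (z / 100)) * ?T" if "a \<in> A 0" for a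
    proof -
      have a: "a \<in> V" "D a = 0" using AL[of 0] that by (auto simp: L_def)
      have "\<tau> \<le> card V" using H by (simp add: \<tau>_def)
      note single_leaf_depth[OF D_root a this, of \<tau>]
      also have "exp (- (real \<tau> * real \<tau> * real (bigs V) / (4 * (real (card V))\<^sup>2))) \<le> exp (- (z / 100))"
      proof -
        \<comment> \<open>From \<open>h >= 20\<close> on, the rounding in \<open>H div 4\<close> is
          absorbed by passing to \<open>h / 5\<close>. The rate 1/100 is (1/5)^2 / 4.\<close>
        have "h < 4 * real \<tau> + 4" unfolding \<tau>_def h_def by linarith
        then have "h / 5 \<le> real \<tau>" using h20 by linarith
        then have "h / 5 * (h / 5) \<le> real \<tau> * real \<tau>" using h20 by (intro mult_mono) auto
        then have "h / 5 * (h / 5) * M / (4 * n^2) \<le> real \<tau> * real \<tau> * M / (4 * n^2)"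
          using M by (intro divide_right_mono mult_right_mono) auto
        moreover have "h / 5 * (h / 5) * M / (4 * n^2) = z / 100"
          unfolding zd by (simp add: power2_eq_square mult.commute)
        ultimately show ?thesis by (simp add: M_def n_def)
      qed
      finally show ?thesis by (simp add: mult_right_mono)
    qed
    then have "real (card {f\<in>trees. ?start f}) \<le> (\<Sum>a\<in>A 0. exp (- (z / 100)) * ?T)"
      using finite_trees AL[of 0] finL by (intro card_bex_le) (auto intro: finite_subset)
    also have "\<dots> = real (card (A 0)) * (exp (- (z / 100)) * ?T)" by simp
    also have "\<dots> \<le> real (512 * kk 0) * (exp (- (z / 100)) * ?T)"
      by (intro mult_right_mono of_nat_mono cardA) auto
    finally show ?thesis by (simp add: kk_def mult.assoc)
  qed
  have bi: "real (card {f\<in>trees. ?bad i f}) \<le> 4096 * k0 * exp (- (z / 100)) * ?T * (1/2) ^ i"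
    if i: "i < J" for i
  proof -
    let ?p = "(1/2) ^ kk i + exp (- (real (t i) * sqrt (real (kk i) * bigs V) / (16 * card V)))"
    have "real (card {f\<in>trees. \<forall>i'\<le>t i. (f ^^ i') l \<notin> spanned (A i) f}) \<le> ?p * ?T"
      if l: "l \<in> A (Suc i) - A i" for l
    proof (rule branch_length[OF D_root])
      show "l \<in> V" "D l = 0" "l \<notin> A i" using l AL[of "Suc i"] by (auto simp: L_def)
      show "A i \<subseteq> V" "\<And>a. a \<in> A i \<Longrightarrow> D a = 0" using AL[of i] by (auto simp: L_def)
      show "card (A i) = kk i" using cardA'[OF i, of l] l AL[of "Suc i"] by auto
      show "1 \<le> kk i" using k0(3) by (simp add: kk_def)
      show "256 * kk i \<le> bigs V" by (rule J[OF i])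
    qed
    then have "real (card {f\<in>trees. ?bad i f}) \<le> (\<Sum>l\<in>A (Suc i) - A i. ?p * ?T)"
      using finite_trees AL[of "Suc i"] finL by (intro card_bex_le) (auto intro: finite_subset)
    also have "\<dots> = real (card (A (Suc i) - A i)) * (?p * ?T)" by simp
    also have "\<dots> \<le> real (512 * kk (Suc i)) * (?p * ?T)"
    proof (intro mult_right_mono of_nat_mono)
      have "finite (A (Suc i))" using AL[of "Suc i"] finL by (rule finite_subset)
      then have "card (A (Suc i) - A i) \<le> card (A (Suc i))" by (intro card_mono) auto
      also have "\<dots> \<le> 512 * kk (Suc i)" using i by (intro cardA) simp
      finally show "card (A (Suc i) - A i) \<le> 512 * kk (Suc i)" .
    qed auto
    \<comment> \<open>The failure probability has to fall like \<open>(1/8) ^ i\<close> in order to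
      beat the growth \<open>4 ^ i\<close> of the number of leaves and leave a geometric
      series.\<close>
    also have "\<dots> \<le> real (512 * kk (Suc i)) * ((2 * exp (- (z / 100)) * (1/8) ^ i) * ?T)"
    proof (intro mult_left_mono mult_right_mono)
      have p1: "(1/2::real) ^ kk i \<le> exp (- (z / 100)) * (1/8) ^ i"
      proof -
        have "1 + real i * 3 \<le> (1 + 3) ^ i" by (rule Bernoulli_inequality) simp
        then have "(1 + real i * 3) * k0 \<le> 4 ^ i * real k0" by (intro mult_right_mono) auto
        moreover have "real i * 3 * 1 \<le> real i * 3 * k0" using k0(3) by (intro mult_left_mono) auto
        ultimately have "real (k0 + 3 * i) \<le> real (kk i)" by (simp add: kk_def algebra_simps)
        then have "k0 + 3 * i \<le> kk i" by (simp only: of_nat_le_iff)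
        then have "(1/2::real) ^ kk i \<le> (1/2) ^ (k0 + 3 * i)" by (intro power_decreasing) auto
        also have "\<dots> = (1/2) ^ k0 * (1/8) ^ i" by (simp add: power_add power_mult power3_eq_cube)
        also have "\<dots> \<le> exp (- (z / 100)) * (1/8) ^ i"
        proof (rule mult_right_mono)
          have e: "exp (1/2::real) \<le> 2"
          proof (rule power2_le_imp_le)
            have "(exp (1/2::real))^2 = exp 1" by (simp add: exp_double[symmetric])
            then show "(exp (1/2::real))^2 \<le> 2^2" using exp_le by simp
          qed simp
          have "exp (z / 100) \<le> exp (real k0 * (1/2))" using k0(1) z(2) by simp
          also have "\<dots> = exp (1/2) ^ k0" by (rule exp_of_nat_mult)
          also have "\<dots> \<le> 2 ^ k0" using e by (intro power_mono) auto
          finally show "(1/2) ^ k0 \<le> exp (- (z / 100))"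
            by (simp add: exp_minus power_one_over field_simps)
        qed simp
        finally show ?thesis .
      qed
      have p2: "exp (- (real (t i) * sqrt (real (kk i) * bigs V) / (16 * card V))) \<le> exp (- (z / 100)) * (1/8) ^ i"
      proof -
        have ki: "4 ^ i * (16 * z) \<le> real (kk i)" using k0(1) by (simp add: kk_def)
        have four: "((2::real) ^ i)^2 = 4 ^ i"
          by (simp add: power2_eq_square flip: power_mult_distrib)
        have sq: "2 ^ i * 4 * M * h / n \<le> sqrt (real (kk i) * M)"
        proof (rule real_le_rsqrt)
          have "(2 ^ i * 4 * M * h / n)^2 = (2 ^ i)^2 * 16 * M * (M * h^2 / n^2)"
            by (simp add: power_mult_distrib power_divide power2_eq_square)
          also have "\<dots> = 4 ^ i * (16 * z) * M"
            unfolding zd four by simp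
          also have "\<dots> \<le> real (kk i) * M" using ki M by (intro mult_right_mono) auto
          finally show "(2 ^ i * 4 * M * h / n)^2 \<le> real (kk i) * M" .
        qed
        \<comment> \<open>The aim is \<open>2 <= h / 8 * (3/4) ^ i\<close>, so that the floor in
          \<open>t i\<close> loses at most half. Since \<open>i < J\<close>, \<open>kk i\<close> is
          at most \<open>M / 256\<close>, which makes \<open>(1/2) ^ i\<close> at least
          \<open>64 * h / n\<close>; \<open>hn\<close> does the rest.\<close>
        have "256 * (4 ^ i * (16 * z)) \<le> 256 * real (kk i)" using ki by (rule mult_left_mono) simp
        also have "\<dots> \<le> M" using J[OF i] unfolding M_def by linarith
        finally have "256 * (4 ^ i * (16 * z)) * n^2 \<le> M * n^2" by (rule mult_right_mono) simp
        moreover have "256 * (4 ^ i * (16 * z)) * n^2 = M * (4096 * 4 ^ i * h^2)"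
          using zn by (simp add: mult.assoc mult.left_commute)
        ultimately have "M * (4096 * 4 ^ i * h^2) \<le> M * n^2" by (simp only:)
        then have "4096 * 4 ^ i * h^2 \<le> n^2" using M by (rule mult_left_le_imp_le)
        moreover have "(64 * 2 ^ i * h)^2 = 4096 * 4 ^ i * h^2"
          unfolding power_mult_distrib[of "64 * 2 ^ i"] power_mult_distrib[of 64] four by (simp only: mult.assoc) simp
        ultimately have "(64 * 2 ^ i * h)^2 \<le> n^2" by (simp only:)
        then have "64 * 2 ^ i * h \<le> n" by (rule power2_le_imp_le) (use n in simp)
        then have "64 * h / n \<le> 1 / 2 ^ i" using n by (simp add: field_simps)
        then have "64 * h / n \<le> (1/2) ^ i" by (simp add: power_one_over)
        also have "(1/2) ^ i \<le> (3/4::real) ^ i" by (intro power_mono) auto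
        finally have "h / 8 * (64 * h / n) \<le> h / 8 * (3/4) ^ i" using h20 by (intro mult_left_mono) auto
        moreover have "32000 \<le> h / 8 * (64 * h / n)" using hn n by (simp add: field_simps power2_eq_square)
        ultimately have "2 \<le> h / 8 * (3/4) ^ i" by linarith
        then have ti: "h / 16 * (3/4) ^ i \<le> real (t i)" unfolding t_def by linarith
        \<comment> \<open>Per level the allowed branch length shrinks by 3/4 while the square root
          doubles, so the exponent grows by 3/2.\<close>
        have "(3/2) ^ i * z / 64 = (h / 16 * (3/4) ^ i) * (2 ^ i * 4 * M * h / n) / (16 * n)"
        proof -
          have "(3/2::real) ^ i = (3/4) ^ i * 2 ^ i" by (simp flip: power_mult_distrib)
          then show ?thesis unfolding zd by (simp add: power2_eq_square mult.commute mult.left_commute)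
        qed
        also have "\<dots> \<le> real (t i) * sqrt (real (kk i) * M) / (16 * n)"
          using ti sq n M h20 by (intro divide_right_mono mult_mono) auto
        finally have e1: "exp (- (real (t i) * sqrt (real (kk i) * bigs V) / (16 * card V))) \<le> exp (- ((3/2) ^ i * z / 64))"
          by (simp add: M_def n_def)
        have "1 + real i * (1/2) \<le> (1 + 1/2) ^ i" by (rule Bernoulli_inequality) simp
        then have "(1 + real i / 2) * z \<le> (3/2) ^ i * z" using z(2) by (intro mult_right_mono) auto
        then have "exp (- ((3/2) ^ i * z / 64)) \<le> exp (- (z / 100) + real i * (- (z / 128)))"
          using z(2) by (simp add: algebra_simps)
        also have "\<dots> = exp (- (z / 100)) * exp (- (z / 128)) ^ i"
          by (simp only: exp_add exp_of_nat_mult)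
        also have "\<dots> \<le> exp (- (z / 100)) * (1/8) ^ i"
        proof (intro mult_left_mono power_mono)
          have "8 \<le> exp (z / 128)" using exp_ge_add_one_self[of "z / 128"] z(2) by linarith
          then show "exp (- (z / 128)) \<le> 1 / 8" by (simp add: exp_minus field_simps)
        qed auto
        finally show ?thesis using e1 by linarith
      qed
      show "?p \<le> 2 * exp (- (z / 100)) * (1/8) ^ i" using p1 p2 by simp
    qed auto
    also have "\<dots> = 4096 * k0 * exp (- (z / 100)) * ?T * ((4::real) ^ i * (1/8) ^ i)"
      by (simp add: kk_def)
    also have "(4::real) ^ i * (1/8) ^ i = (1/2) ^ i" by (simp flip: power_mult_distrib)
    finally show ?thesis .
  qed
  have "real (card {f\<in>trees. \<exists>l\<in>V. D l = 0 \<and> (f ^^ H) l \<noteq> r}) \<le>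
      real (card ({f\<in>trees. ?start f} \<union> {f\<in>trees. \<exists>i\<in>{..<J}. ?bad i f}))"
    using finite_trees by (intro of_nat_mono card_mono[OF _ sub]) auto
  also have "\<dots> \<le> real (card {f\<in>trees. ?start f}) + real (card {f\<in>trees. \<exists>i\<in>{..<J}. ?bad i f})"
    using card_Un_le[of "{f\<in>trees. ?start f}" "{f\<in>trees. \<exists>i\<in>{..<J}. ?bad i f}"] by linarith
  also have "real (card {f\<in>trees. \<exists>i\<in>{..<J}. ?bad i f}) \<le>
      (\<Sum>i<J. 4096 * k0 * exp (- (z / 100)) * ?T * (1/2) ^ i)"
    using finite_trees bi by (intro card_bex_le) auto
  also have "\<dots> = 4096 * k0 * exp (- (z / 100)) * ?T * (\<Sum>i<J. (1/2) ^ i)"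
    by (simp add: sum_distrib_left)
  also have "\<dots> \<le> 4096 * k0 * exp (- (z / 100)) * ?T * (1 / (1 - 1/2))"
    by (intro mult_left_mono geometric_sum_le) auto
  \<comment> \<open>8704 is 512 for the start plus twice 4096 for the geometric series; times 17 it
    stays below 150000.\<close>
  finally have "real (card {f\<in>trees. \<exists>l\<in>V. D l = 0 \<and> (f ^^ H) l \<noteq> r}) \<le>
      8704 * (k0 * (exp (- (z / 100)) * ?T))"
    using b0 by simp
  also have "\<dots> \<le> 8704 * ((17 * z) * (exp (- (z / 100)) * ?T))"
    using k0(2) by (intro mult_left_mono mult_right_mono) auto
  also have "\<dots> \<le> 150000 * z * exp (- (z / 100)) * ?T"
    using z(2) by (simp add: mult_right_mono)
  finally show ?thesis .
qed

end

subsection \<open>Rooted graphs and parent functions\<close>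

context rooted_degrees begin

lemma tree_reaches_root:
  assumes "f \<in> trees"
  shows "\<exists>i. (f ^^ i) v = r"
proof (cases "v \<in> V")
  case True
  then have "(v, r) \<in> (steps_on V f)\<^sup>*" using assms by (simp add: trees_def)
  from steps_on_rtrancl_funpow[OF this] show ?thesis by metis
next
  case False
  then show ?thesis using assms by (intro exI[of _ 1]) (simp add: trees_def)
qed

definition depth :: "('a \<Rightarrow> 'a) \<Rightarrow> 'a \<Rightarrow> nat" where
  "depth f v = (LEAST i. (f ^^ i) v = r)"

lemma depth_parent:
  assumes "f \<in> trees" "v \<in> V"
  shows "depth f v = Suc (depth f (f v))"
proof -
  obtain i where "(f ^^ i) v = r" using tree_reaches_root[OF assms(1)] by blast
  moreover have "(f ^^ 0) v \<noteq> r" using assms(2) r_notin by auto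
  ultimately have "depth f v = Suc (LEAST i. (f ^^ Suc i) v = r)"
    unfolding depth_def by (rule Least_Suc)
  then show ?thesis by (simp only: depth_def funpow_Suc_right comp_apply)
qed

text \<open>Take a vertex of maximal depth among those that do not reach \<open>r\<close> within
  \<open>h\<close> steps. A child of it would be another such vertex and deeper.\<close>

lemma deep_leaf:
  assumes f: "f \<in> trees" and w: "w \<in> V" "(f ^^ h) w \<noteq> r"
  shows "\<exists>l\<in>V. D l = 0 \<and> (f ^^ h) l \<noteq> r"
proof -
  let ?X = "{v\<in>V. (f ^^ h) v \<noteq> r}"
  have fin: "finite (depth f ` ?X)" and ne: "depth f ` ?X \<noteq> {}" using finite_V w by auto
  obtain l where l: "l \<in> ?X" "depth f l = Max (depth f ` ?X)"
    using Max_in[OF fin ne] by (metis (lifting) imageE)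
  have max: "depth f v \<le> depth f l" if "v \<in> ?X" for v
    unfolding l(2) using fin that by (intro Max_ge) auto
  have "D l = 0"
  proof (rule ccontr)
    assume "D l \<noteq> 0"
    moreover have "card {v\<in>V. f v = l} = D l" using f l(1) by (simp add: trees_def)
    ultimately have "{v\<in>V. f v = l} \<noteq> {}" by (metis card.empty)
    then obtain c where c: "c \<in> V" "f c = l" by blast
    have "(f ^^ h) c \<noteq> r"
    proof
      assume "(f ^^ h) c = r"
      then have "(f ^^ Suc h) c = r" by (rule tree_root_absorbing[OF f]) simp
      then have "(f ^^ h) l = r" using c(2) by (simp only: funpow_Suc_right comp_apply)
      then show False using l(1) by blast
    qed
    then have "depth f c \<le> depth f l" using c(1) by (intro max) simp
    then show False using depth_parent[OF f c(1)] c(2) by simp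
  qed
  then show ?thesis using l(1) by blast
qed

end

text \<open>The last step leads from the root \<open>\<rho>\<close> to the virtual parent, hence
  \<open>Suc i\<close> applications of \<open>f\<close> against a walk of length at most
  \<open>i\<close>.\<close>

lemma walk_upwards:
  fixes f :: "'a \<Rightarrow> 'a"
  assumes G: "pair_graph G" and \<rho>: "\<rho> \<in> pverts G" and r: "r \<notin> pverts G"
    and step: "\<And>v. v \<in> pverts G \<Longrightarrow> v \<noteq> \<rho> \<Longrightarrow> f v \<in> pverts G \<and> (f v, v) \<in> parcs G"
    and v: "v \<in> pverts G" "(f ^^ Suc i) v = r"
  shows "\<exists>p. pre_digraph.awalk (with_proj G) \<rho> p v \<and> length p \<le> i"
  using v
proof (induction i arbitrary: v)
  interpret pair_graph G by (rule G)
  case 0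
  have "v = \<rho>" using step[OF 0(1)] 0(2) r by auto
  then show ?case using \<rho> by (intro exI[of _ "[]"]) (simp add: awalk_Nil_iff)
next
  interpret pair_graph G by (rule G)
  case (Suc i)
  show ?case
  proof (cases "v = \<rho>")
    case True
    then show ?thesis using \<rho> by (intro exI[of _ "[]"]) (simp add: awalk_Nil_iff)
  next
    case False
    note s = step[OF Suc.prems(1) False]
    have "(f ^^ Suc i) (f v) = r" using Suc.prems(2) by (simp only: funpow_Suc_right comp_apply)
    from Suc.IH[OF _ this] s obtain p where p: "awalk \<rho> p (f v)" "length p \<le> i" by blast
    have "awalk (f v) [(f v, v)] v" using s Suc.prems(1) by (simp add: awalk_simps)
    from awalk_appendI[OF p(1) this] p(2) show ?thesis by (intro exI[of _ "p @ [(f v, v)]"]) simp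
  qed
qed

lemma children_iff:
  "w \<in> children (G, \<rho>) v \<longleftrightarrow> (\<exists>p. pre_digraph.apath (with_proj G) \<rho> (p @ [(v, w)]) w)"
  by (simp add: children_def)

lemma connected_apath:
  assumes "pair_graph G" "Digraph_Component.connected (with_proj G)" "u \<in> pverts G" "v \<in> pverts G"
  shows "\<exists>p. pre_digraph.apath (with_proj G) u p v"
proof -
  interpret pair_graph G by fact
  have "u \<rightarrow>\<^sup>*\<^bsub>mk_symmetric (with_proj G)\<^esub> v"
    using assms(2-4) by (auto simp: connected_def strongly_connected_def)
  then have "u \<rightarrow>\<^sup>*\<^bsub>with_proj G\<^esub> v"
    using reachable_mk_symmetric_eq[OF sym_arcs] by simp
  then obtain p where "awalk u p v" unfolding reachable_awalk by blast
  then show ?thesis using apath_awalk_to_apath by blast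
qed

lemma children_of_last_arc:
  assumes "pair_graph G" "pre_digraph.apath (with_proj G) \<rho> p w" "w \<noteq> \<rho>"
  obtains p' v where "p = p' @ [(v, w)]" "w \<in> children (G, \<rho>) v"
    "pre_digraph.apath (with_proj G) \<rho> p' v" "v \<in> pverts G" "(v, w) \<in> parcs G"
proof -
  interpret pair_graph G by fact
  have "p \<noteq> []" using assms(2,3) by (auto simp: apath_Nil_iff)
  then obtain p' e where p: "p = p' @ [e]" by (metis rev_exhaust)
  obtain v w' where e: "e = (v, w')" by (cases e)
  have "apath \<rho> (p' @ [(v, w')]) w" using assms(2) by (simp add: p e)
  then have *: "apath \<rho> p' (awlast \<rho> p')" "apath (awlast \<rho> p') [(v, w')] w"
    by (simp_all add: apath_append_iff)
  from *(2) have v: "v = awlast \<rho> p'" "w' = w" "(v, w) \<in> parcs G" by (auto simp: apath_simps)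
  show ?thesis
  proof
    show "p = p' @ [(v, w)]" using p e v by simp
    then show "w \<in> children (G, \<rho>) v" using assms(2) by (auto simp: children_iff)
    show "apath \<rho> p' v" using * v by simp
    show "(v, w) \<in> parcs G" by (rule v(3))
    then show "v \<in> pverts G" by (rule in_arcsD1)
  qed
qed

lemma childrenD:
  assumes "pair_graph G" "w \<in> children (G, \<rho>) v"
  shows "w \<in> pverts G" "w \<noteq> \<rho>" "(v, w) \<in> parcs G" "v \<in> pverts G"
proof -
  interpret pair_graph G by fact
  obtain p where p: "apath \<rho> (p @ [(v, w)]) w" using assms(2) by (auto simp: children_iff)
  show "w \<noteq> \<rho>" using apath_nonempty_ends[OF p] by simp
  show vw: "(v, w) \<in> parcs G" using p by (auto simp: apath_append_iff apath_simps)
  then show "w \<in> pverts G" "v \<in> pverts G" by (auto dest: wellformed')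
qed

text \<open>By counting: the last arc of a path from the root gives each other vertex at least one
  parent, and by the degree sum there are as many pairs of parent and child as vertices other than
  the root.\<close>

lemma unique_parent:
  assumes G: "pair_graph G" "Digraph_Component.connected (with_proj G)" "\<rho> \<in> pverts G"
    and sum: "(\<Sum>v\<in>pverts G. card (children (G, \<rho>) v)) + 1 = card (pverts G)"
    and w: "w \<in> pverts G" "w \<noteq> \<rho>"
  shows "\<exists>!v. w \<in> children (G, \<rho>) v"
proof -
  interpret pair_graph G by fact
  let ?V = "pverts G" and ?W = "pverts G - {\<rho>}" and ?R = "\<lambda>v w. w \<in> children (G, \<rho>) v"
  define c where "c w = card {v\<in>?V. ?R v w}" for w
  have fin: "finite ?V" by (rule pair_finite_verts)
  have ex: "c w \<ge> 1" if w: "w \<in> ?W" for w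
  proof -
    obtain p where "apath \<rho> p w" using connected_apath[OF G, of w] w by blast
    then obtain v where "v \<in> ?V" "?R v w" using children_of_last_arc[OF G(1), of \<rho> p w] w by blast
    then have "{v\<in>?V. ?R v w} \<noteq> {}" by blast
    then show ?thesis using fin by (simp add: c_def Suc_le_eq card_gt_0_iff)
  qed
  have "(\<Sum>v\<in>?V. card (children (G, \<rho>) v)) = (\<Sum>v\<in>?V. \<Sum>w\<in>?W. if ?R v w then 1 else 0)"
  proof (rule sum.cong)
    fix v assume "v \<in> ?V"
    have "children (G, \<rho>) v = {w\<in>?W. ?R v w}" using childrenD[OF G(1)] by blast
    then show "card (children (G, \<rho>) v) = (\<Sum>w\<in>?W. if ?R v w then 1 else 0)"
      using fin by (simp add: sum.If_cases Int_def)
  qed simp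
  also have "\<dots> = (\<Sum>w\<in>?W. \<Sum>v\<in>?V. if ?R v w then 1 else 0)" by (rule sum.swap)
  also have "\<dots> = (\<Sum>w\<in>?W. c w)"
    using fin by (simp add: sum.If_cases Int_def c_def)
  finally have "(\<Sum>w\<in>?W. c w) = card ?W"
    using sum G(3) fin by simp
  moreover have "(\<Sum>w\<in>?W. c w) = (\<Sum>w\<in>?W. c w - 1) + card ?W"
  proof -
    have "(\<Sum>w\<in>?W. c w) = (\<Sum>w\<in>?W. (c w - 1) + 1)"
    proof (rule sum.cong)
      fix w assume "w \<in> ?W"
      then show "c w = (c w - 1) + 1" using ex[of w] by simp
    qed simp
    also have "\<dots> = (\<Sum>w\<in>?W. c w - 1) + card ?W"
      unfolding sum.distrib card_eq_sum ..
    finally show ?thesis .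
  qed
  ultimately have "(\<Sum>w\<in>?W. c w - 1) = 0" by simp
  then have "c w - 1 = 0" using fin w by (simp add: sum_eq_0_iff)
  then have "c w = 1" using ex[of w] w by simp
  then obtain v where v: "{v\<in>?V. ?R v w} = {v}" unfolding c_def by (auto simp: card_1_singleton_iff)
  show ?thesis
  proof (rule ex1I[of _ v])
    show "?R v w" using v by blast
    show "v' = v" if "?R v' w" for v' using v childrenD(4)[OF G(1) that] that by blast
  qed
qed

section \<open>From rooted graphs to parent functions\<close>

locale unique_root = rooted_degrees +
  assumes D_root: "D r = 1"
begin

definition graph_trees :: "'a rooted_graph set" where
  "graph_trees = {t. rooted_tree t \<and> pverts (fst t) = V \<and> (\<forall>i\<in>V. card (children t i) = D i)}"

text \<open>The value \<open>r\<close> at the root and outside \<open>V\<close> follows the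
  convention of \<open>trees\<close>; elsewhere \<open>unique_parent\<close> makes the description
  proper.\<close>

definition parent :: "'a rooted_graph \<Rightarrow> 'a \<Rightarrow> 'a" where
  "parent t w = (if w \<in> V \<and> w \<noteq> snd t then THE v. w \<in> children t v else r)"

lemma sum_D_V: "(\<Sum>v\<in>V. D v) + 1 = card V"
  using sum_D finite_V r_notin D_root by simp

context
  fixes G :: "'a pair_pre_digraph" and \<rho> :: 'a
  assumes t: "(G, \<rho>) \<in> graph_trees"
begin

lemma graph_treeD:
  shows "pair_graph G" "Digraph_Component.connected (with_proj G)" "\<rho> \<in> pverts G" "pverts G = V"
    "\<And>p. pre_digraph.cycle (with_proj G) p \<Longrightarrow> length p < 3"
    "\<And>i. i \<in> V \<Longrightarrow> card (children (G, \<rho>) i) = D i"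
  using t by (auto simp: graph_trees_def rooted_tree_def undirected_tree_def not_le)

lemma parent_children:
  assumes "w \<in> V" "w \<noteq> \<rho>"
  shows "w \<in> children (G, \<rho>) v \<longleftrightarrow> parent (G, \<rho>) w = v"
proof -
  have "(\<Sum>v\<in>pverts G. card (children (G, \<rho>) v)) + 1 = card (pverts G)"
    using sum_D_V graph_treeD(4,6) by simp
  from unique_parent[OF graph_treeD(1-3) this, of w] assms graph_treeD(4)
  have ex1: "\<exists>!v. w \<in> children (G, \<rho>) v" by simp
  show ?thesis using theI'[OF ex1] ex1 assms by (auto simp: parent_def)
qed

lemma parent_nonroot:
  assumes "w \<in> V" "w \<noteq> \<rho>"
  shows "parent (G, \<rho>) w \<in> V" "(parent (G, \<rho>) w, w) \<in> parcs G"
  using childrenD[OF graph_treeD(1), of w \<rho> "parent (G, \<rho>) w"] parent_children[OF assms] graph_treeD(4)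
  by simp_all

lemma parent_root: "parent (G, \<rho>) \<rho> = r"
  by (simp add: parent_def)

lemma parent_in_trees: "parent (G, \<rho>) \<in> trees"
proof -
  let ?f = "parent (G, \<rho>)"
  have \<rho>: "\<rho> \<in> V" using graph_treeD(3,4) by simp
  have "card {v\<in>V. ?f v = u} = D u" if "u \<in> insert r V" for u
  proof (cases "u = r")
    case True
    have "x = \<rho>" if "x \<in> V" "?f x = r" for x
      using parent_nonroot(1)[of x] that r_notin by metis
    then have "{v\<in>V. ?f v = u} = {\<rho>}" using True \<rho> parent_root by blast
    then show ?thesis using True D_root by simp
  next
    case False
    have "{v\<in>V. ?f v = u} = children (G, \<rho>) u"
      using parent_children parent_root childrenD(1,2)[OF graph_treeD(1)] graph_treeD(4) False by blast
    then show ?thesis using graph_treeD(6) that False by simp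
  qed
  moreover have "(w, r) \<in> (steps_on V ?f)\<^sup>*" if "pre_digraph.apath (with_proj G) \<rho> p w" for p w
    using that
  proof (induction "length p" arbitrary: p w)
    case 0
    interpret pair_graph G by (rule graph_treeD)
    have "w = \<rho>" using 0 by (simp add: apath_Nil_iff)
    then show ?case using \<rho> parent_root by (simp add: steps_on_rtrancl_into)
  next
    case (Suc k)
    interpret pair_graph G by (rule graph_treeD)
    have "w \<noteq> \<rho>" using apath_ends[OF Suc.prems Suc.prems] Suc.hyps(2) by auto
    from children_of_last_arc[OF graph_treeD(1) Suc.prems this] obtain p' v where
      p: "p = p' @ [(v, w)]" "w \<in> children (G, \<rho>) v" "apath \<rho> p' v" by metis
    have wV: "w \<in> V" using childrenD(1)[OF graph_treeD(1) p(2)] graph_treeD(4) by simp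
    have "(v, r) \<in> (steps_on V ?f)\<^sup>*" using Suc.hyps p by auto
    then show ?case
      using parent_children[OF wV \<open>w \<noteq> \<rho>\<close>] p(2) wV by (simp add: steps_on_rtrancl_into)
  qed
  then have "(w, r) \<in> (steps_on V ?f)\<^sup>*" if "w \<in> V" for w
    using connected_apath[OF graph_treeD(1-3), of w] that graph_treeD(4) by blast
  moreover have "?f v = r" if "v \<notin> V" for v using that by (simp add: parent_def)
  moreover have "?f v \<in> insert r V" if "v \<in> V" for v
    using parent_nonroot(1)[OF that] parent_root by (cases "v = \<rho>") auto
  ultimately show ?thesis by (simp add: trees_def)
qed

text \<open>For an arc from \<open>v\<close> to \<open>w\<close> take a path from the root to
  \<open>v\<close>. If it avoids \<open>w\<close>, the arc extends it and \<open>w\<close> is a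
  child of \<open>v\<close>. Otherwise its part from \<open>w\<close> to \<open>v\<close> and the
  arc form a closed walk; having no cycle of length at least 3 forces that part to be a single arc,
  so \<open>v\<close> is a child of \<open>w\<close>.\<close>

lemma parcs_parent:
  "parcs G = {(parent (G, \<rho>) v, v) |v. v \<in> V - {\<rho>}} \<union> {(v, parent (G, \<rho>) v) |v. v \<in> V - {\<rho>}}"
proof -
  interpret pair_graph G by (rule graph_treeD)
  have sub: "v \<in> V - {\<rho>} \<and> parent (G, \<rho>) v = w \<or> w \<in> V - {\<rho>} \<and> parent (G, \<rho>) w = v"
    if vw: "(v, w) \<in> parcs G" for v w
  proof -
    have V: "v \<in> V" "w \<in> V" using wellformed'[OF vw] graph_treeD(4) by auto
    obtain p where p: "apath \<rho> p v" using connected_apath[OF graph_treeD(1-3), of v] V graph_treeD(4) by auto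
    show ?thesis
    proof (cases "w \<in> set (awalk_verts \<rho> p)")
      case False
      have "awlast \<rho> p = v" using p by (auto simp: apath_def)
      then have "apath \<rho> (p @ [(v, w)]) w"
        using p False vw V graph_treeD(4) no_loops'[OF vw] by (auto simp: apath_append_iff apath_simps)
      then have c: "w \<in> children (G, \<rho>) v" by (auto simp: children_iff)
      then show ?thesis
        using parent_children[OF V(2)] childrenD(2)[OF graph_treeD(1) c] V by blast
    next
      case True
      then obtain q s where qs: "p = q @ s" "awalk \<rho> q w" "awalk w s v"
        using awalk_decomp[of \<rho> p v w] p unfolding apath_def by blast
      have last: "awlast \<rho> q = w" using qs(2) by auto
      have as: "apath \<rho> q w" "apath w s v" using p qs last by (auto simp: apath_append_iff)
      have "s \<noteq> []" using as(2) no_loops'[OF vw] by (auto simp: apath_Nil_iff)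
      show ?thesis
      proof (cases "length s \<ge> 2")
        case True
        have "awalk w (s @ [(v, w)]) w"
          using as(2) vw V graph_treeD(4) by (intro awalk_appendI[of w s v]) (auto simp: apath_def awalk_simps)
        moreover have "distinct (tl (awalk_verts w (s @ [(v, w)])))"
        proof -
          have "awalk_verts w (s @ [(v, w)]) = awalk_verts w s @ [w]"
            using awalk_verts_append[OF calculation] as(2) by (auto simp: apath_def)
          moreover obtain vs where "awalk_verts w s = w # vs"
            using as(2) by (cases s) (auto simp: apath_simps)
          ultimately show ?thesis using as(2) by (auto simp: apath_def)
        qed
        ultimately have "cycle (s @ [(v, w)])" by (auto simp: cycle_def)
        then show ?thesis using graph_treeD(5)[of "s @ [(v, w)]"] True by simp
      next
        case False
        obtain e es where s: "s = e # es" using \<open>s \<noteq> []\<close> by (cases s) auto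
        with False have "s = [e]" by (cases es) auto
        then have "s = [(w, v)]" using as(2) by (cases e) (auto simp: apath_simps)
        then have c: "v \<in> children (G, \<rho>) w" using p qs(1) by (auto simp: children_iff)
        then show ?thesis
          using parent_children[OF V(1)] childrenD(2)[OF graph_treeD(1) c] V by blast
      qed
    qed
  qed
  have sup: "(v, parent (G, \<rho>) v) \<in> parcs G" "(parent (G, \<rho>) v, v) \<in> parcs G" if "v \<in> V - {\<rho>}" for v
    using parent_nonroot(2)[of v] that arcs_symmetric by auto
  show ?thesis
  proof (rule set_eqI)
    fix e :: "'a \<times> 'a"
    obtain v w where e: "e = (v, w)" by (cases e)
    show "e \<in> parcs G \<longleftrightarrow> e \<in> {(parent (G, \<rho>) v, v) |v. v \<in> V - {\<rho>}} \<union> {(v, parent (G, \<rho>) v) |v. v \<in> V - {\<rho>}}"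
      unfolding e using sub[of v w] sup by blast
  qed
qed

lemma tree_height_parent:
  assumes "h \<le> tree_height (G, \<rho>)"
  shows "\<exists>w\<in>V. (parent (G, \<rho>) ^^ h) w \<noteq> r"
proof -
  let ?f = "parent (G, \<rho>)"
  have \<rho>: "\<rho> \<in> V" using graph_treeD(3,4) by simp
  have "Max (graph_dist G \<rho> ` V) \<in> graph_dist G \<rho> ` V"
    using finite_V \<rho> by (intro Max_in) auto
  then obtain w where w: "w \<in> V" "h \<le> graph_dist G \<rho> w"
    using assms graph_treeD(4) by (auto simp: tree_height_def)
  have "(?f ^^ h) w \<noteq> r"
  proof (cases h)
    case 0
    then show ?thesis using w(1) r_notin by auto
  next
    case (Suc i)
    show ?thesis
    proof
      assume "(?f ^^ h) w = r"
      then obtain p where "pre_digraph.awalk (with_proj G) \<rho> p w" "length p \<le> i"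
        using walk_upwards[OF graph_treeD(1,3), of r ?f w i] parent_nonroot w(1) r_notin graph_treeD(4) Suc by auto
      moreover from this(1) have "graph_dist G \<rho> w \<le> length p"
        unfolding graph_dist_def by (intro Least_le) auto
      ultimately show False using w(2) Suc by simp
    qed
  qed
  then show ?thesis using w(1) by blast
qed

end

text \<open>The root is recovered as the only vertex of \<open>V\<close> mapped to \<open>r\<close>,
  the arcs by \<open>parcs_parent\<close>.\<close>

lemma parent_inj: "inj_on parent graph_trees"
proof (rule inj_onI)
  fix t t' assume t: "t \<in> graph_trees" "t' \<in> graph_trees" and eq: "parent t = parent t'"
  obtain G \<rho> G' \<rho>' where t_eq: "t = (G, \<rho>)" "t' = (G', \<rho>')" by (metis surj_pair)
  note t1 = t(1)[unfolded t_eq] and t2 = t(2)[unfolded t_eq]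
  have "\<rho>' \<in> V" using graph_treeD(3,4)[OF t2] by simp
  moreover have "parent (G, \<rho>) \<rho>' = r" using eq parent_root[OF t2] t_eq by simp
  ultimately have \<rho>: "\<rho>' = \<rho>" using parent_nonroot(1)[OF t1, of \<rho>'] r_notin by auto
  have "pverts G = pverts G'" using graph_treeD(4)[OF t1] graph_treeD(4)[OF t2] by simp
  moreover have "parcs G = parcs G'"
    unfolding parcs_parent[OF t1] parcs_parent[OF t2] using eq t_eq \<rho> by simp
  ultimately have "G = G'" by (simp add: pair_pre_digraph.equality)
  then show "t = t'" using t_eq \<rho> by simp
qed

section \<open>From parent functions to rooted graphs\<close>

definition root_of :: "('a \<Rightarrow> 'a) \<Rightarrow> 'a" where
  "root_of f = (THE v. v \<in> V \<and> f v = r)"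

definition tree_graph :: "('a \<Rightarrow> 'a) \<Rightarrow> 'a pair_pre_digraph" where
  "tree_graph f = \<lparr>pverts = V, parcs = {(f v, v) |v. v \<in> V \<and> f v \<noteq> r} \<union> {(v, f v) |v. v \<in> V \<and> f v \<noteq> r}\<rparr>"

context
  fixes f :: "'a \<Rightarrow> 'a"
  assumes f: "f \<in> trees"
begin

lemma root_of_iff: "v \<in> V \<and> f v = r \<longleftrightarrow> v = root_of f"
proof -
  have "card {v\<in>V. f v = r} = 1" using f D_root by (simp add: trees_def)
  then obtain \<rho> where "{v\<in>V. f v = r} = {\<rho>}" by (auto simp: card_1_singleton_iff)
  then have *: "v \<in> V \<and> f v = r \<longleftrightarrow> v = \<rho>" for v by blast
  then have "root_of f = \<rho>" unfolding root_of_def by simp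
  then show ?thesis using * by simp
qed

lemma parent_in_V: "v \<in> V \<Longrightarrow> f v \<noteq> r \<Longrightarrow> f v \<in> V"
  using f by (auto simp: trees_def)

lemma tree_graph_simps [simp]:
  "pverts (tree_graph f) = V"
  "(v, w) \<in> parcs (tree_graph f) \<longleftrightarrow> v \<in> V \<and> w \<in> V \<and> (f w = v \<or> f v = w)"
  using parent_in_V r_notin by (auto simp: tree_graph_def)

lemma tree_graph_pair_graph: "pair_graph (tree_graph f)"
proof
  show "fst e \<in> pverts (tree_graph f)" "snd e \<in> pverts (tree_graph f)"
    if "e \<in> parcs (tree_graph f)" for e
    using that by (cases e; simp)+
  show "finite (pverts (tree_graph f))" using finite_V by simp
  have "parcs (tree_graph f) \<subseteq> V \<times> V" by auto
  then show "finite (parcs (tree_graph f))" by (rule finite_subset) (simp add: finite_V)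
  show "fst e \<noteq> snd e" if "e \<in> parcs (tree_graph f)" for e
  proof
    assume eq: "fst e = snd e"
    obtain v where e: "e = (v, v)" using eq by (metis prod.collapse)
    have "v \<in> V" "f v = v" using that unfolding e by auto
    then show False using depth_parent[OF f, of v] by simp
  qed
  show "symmetric (with_proj (tree_graph f))"
    unfolding symmetric_def by (auto intro!: symI)
qed

lemma tree_graph_awalk:
  assumes "v \<in> V"
  shows "\<exists>p. pre_digraph.awalk (with_proj (tree_graph f)) (root_of f) p v"
proof -
  have \<rho>: "root_of f \<in> V" using root_of_iff by blast
  obtain i where "(f ^^ i) v = r" using tree_reaches_root[OF f] by blast
  then have i: "(f ^^ Suc i) v = r" by (rule tree_root_absorbing[OF f]) simp
  have step: "f u \<in> V \<and> (f u, u) \<in> parcs (tree_graph f)" if "u \<in> V" "u \<noteq> root_of f" for u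
    using that parent_in_V root_of_iff by auto
  show ?thesis
    using walk_upwards[OF tree_graph_pair_graph, of "root_of f" r f v i] step i \<rho> r_notin assms by auto
qed

lemma tree_graph_connected: "Digraph_Component.connected (with_proj (tree_graph f))"
proof -
  interpret pair_graph "tree_graph f" by (rule tree_graph_pair_graph)
  have "root_of f \<rightarrow>\<^sup>*\<^bsub>with_proj (tree_graph f)\<^esub> v" if "v \<in> V" for v
    using tree_graph_awalk[OF that] unfolding reachable_awalk .
  then have "u \<rightarrow>\<^sup>*\<^bsub>with_proj (tree_graph f)\<^esub> v" if "u \<in> V" "v \<in> V" for u v
    using that by (intro reachable_trans[OF symmetric_reachable', of "root_of f" u v])
  then have "u \<rightarrow>\<^sup>*\<^bsub>mk_symmetric (with_proj (tree_graph f))\<^esub> v" if "u \<in> V" "v \<in> V" for u v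
    using that by (intro reachable_mk_symmetricI)
  moreover have "V \<noteq> {}" using root_of_iff by blast
  ultimately show ?thesis
    unfolding connected_def strongly_connected_def
    by simp
qed

text \<open>If the last arc went up, it would return to the vertex before it on the path, because by
  induction the path came down from there; and from the root there is no way up.\<close>

lemma tree_graph_descending:
  assumes "pre_digraph.apath (with_proj (tree_graph f)) (root_of f) p w" "(a, b) \<in> set p"
  shows "f b = a"
  using assms
proof (induction p arbitrary: w a b rule: rev_induct)
  case (snoc e p)
  interpret pair_graph "tree_graph f" by (rule tree_graph_pair_graph)
  obtain c d where e: "e = (c, d)" by (cases e)
  note ap = snoc.prems(1)[unfolded e]
  have p: "apath (root_of f) p c" and cd: "(c, d) \<in> parcs (tree_graph f)"
    and dp: "d \<notin> set (awalk_verts (root_of f) p)"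
    using ap by (auto simp: apath_append_iff apath_simps)
  have "f d = c"
  proof (rule ccontr)
    assume "f d \<noteq> c"
    then have fc: "f c = d" "c \<in> V" "d \<in> V" using cd by auto
    show False
    proof (cases p rule: rev_cases)
      case Nil
      then have "c = root_of f" using p by (simp add: apath_Nil_iff)
      then show False using root_of_iff[of c] fc r_notin by auto
    next
      case (snoc p' e')
      obtain a' b' where e': "e' = (a', b')" by (cases e')
      have "b' = c" using p snoc e' by (auto simp: apath_append_iff apath_simps)
      moreover have "f b' = a'" using snoc.IH[OF p, of a' b'] snoc e' by simp
      ultimately have "a' = d" using fc by simp
      moreover have "a' \<in> set (awalk_verts (root_of f) p)"
        using awalk_verts_arc1[of e' p "root_of f"] snoc e' by simp
      ultimately show False using dp by simp
    qed
  qed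
  then show ?case using snoc.IH[OF p, of a b] snoc.prems(2) e by auto
qed simp

lemma tree_graph_children:
  assumes "v \<in> V"
  shows "children (tree_graph f, root_of f) v = {w\<in>V. f w = v}"
proof (rule set_eqI, rule iffI)
  fix w assume w: "w \<in> children (tree_graph f, root_of f) v"
  then obtain p where "pre_digraph.apath (with_proj (tree_graph f)) (root_of f) (p @ [(v, w)]) w"
    by (auto simp: children_iff)
  from tree_graph_descending[OF this, of v w] childrenD(1)[OF tree_graph_pair_graph w]
  show "w \<in> {w\<in>V. f w = v}" by simp
next
  fix w assume "w \<in> {w\<in>V. f w = v}"
  then have w: "w \<in> V" "f w = v" by auto
  have ne: "w \<noteq> root_of f" using root_of_iff[of w] w assms r_notin by auto
  have "root_of f \<in> V" using root_of_iff by blast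
  then obtain p where p: "pre_digraph.apath (with_proj (tree_graph f)) (root_of f) p w"
    using connected_apath[OF tree_graph_pair_graph tree_graph_connected, of "root_of f" w] w by auto
  obtain p' a where a: "p = p' @ [(a, w)]" "w \<in> children (tree_graph f, root_of f) a"
    using children_of_last_arc[OF tree_graph_pair_graph p ne] by blast
  have "f w = a" by (rule tree_graph_descending[OF p]) (simp add: a(1))
  then show "w \<in> children (tree_graph f, root_of f) v" using a(2) w(2) by simp
qed

lemma pcas_nth:
  assumes "pcas u p v" "Suc i < length p"
  shows "fst (p ! Suc i) = snd (p ! i)"
  using assms
proof (induction p arbitrary: u i)
  case (Cons e p)
  then show ?case by (cases i) (cases p; auto)+
qed simp

text \<open>At a deepest vertex of a cycle both neighbours must be its parent, whereas they are
  distinct on a cycle of length at least 3.\<close>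

lemma tree_graph_acyclic:
  assumes "pre_digraph.cycle (with_proj (tree_graph f)) p"
  shows "length p < 3"
proof (rule ccontr)
  interpret pair_graph "tree_graph f" by (rule tree_graph_pair_graph)
  assume "\<not> length p < 3"
  then have L: "length p \<ge> 3" by simp
  obtain u where u: "awalk u p u" "distinct (tl (awalk_verts u p))" "p \<noteq> []"
    using assms by (auto simp: cycle_def)
  let ?L = "length p"
  \<comment> \<open>The vertices of the cycle, indexed periodically so that successor and
    predecessor need no case distinction at the ends.\<close>
  define c where "c i = snd (p ! (i mod ?L))" for i
  have cas: "pcas u p u" using u(1) by (auto simp: awalk_def)
  have "awalk_verts u p = fst (hd p) # map snd p"
    using awalk_verts_conv'[of u p u] cas u(3) by simp
  then have dist: "distinct (map snd p)" using u(2) by simp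
  have c_inj: "i mod ?L = j mod ?L" if "c i = c j" for i j
    using that dist nth_eq_iff_index_eq[OF dist, of "i mod ?L" "j mod ?L"] u(3) by (simp add: c_def)
  have arc: "(c i, c (Suc i)) \<in> parcs (tree_graph f)" for i
  proof -
    have lt: "i mod ?L < ?L" using u(3) by simp
    have "fst (p ! (Suc i mod ?L)) = c i"
    proof (cases "Suc (i mod ?L) < ?L")
      case True
      then show ?thesis using pcas_nth[OF cas True] by (simp add: c_def mod_Suc)
    next
      case False
      then have last: "Suc (i mod ?L) = ?L" using lt by simp
      have "awlast u p = u" using u(1) by auto
      then have "snd (last p) = u" using u(3) by (simp add: awalk_verts_conv)
      moreover have "fst (hd p) = u" using cas u(3) by (cases p) auto
      moreover have "Suc i mod ?L = 0" using last by (simp add: mod_Suc)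
      moreover have "last p = p ! (i mod ?L)" using last u(3) by (metis diff_Suc_1 last_conv_nth)
      ultimately show ?thesis using u(3) by (simp add: c_def hd_conv_nth)
    qed
    moreover have "p ! (Suc i mod ?L) \<in> parcs (tree_graph f)"
      using u(1,3) by (auto simp: awalk_def intro!: subsetD[OF _ nth_mem])
    ultimately show ?thesis by (metis c_def prod.collapse)
  qed
  have step: "c (Suc i) \<in> V" "c i \<in> V" "f (c (Suc i)) = c i \<or> f (c i) = c (Suc i)" for i
    using arc[of i] by auto
  let ?X = "(\<lambda>i. depth f (c i)) ` {..<?L}"
  have fin: "finite ?X" and ne: "?X \<noteq> {}" using u(3) by auto
  obtain i where i: "depth f (c i) = Max ?X" using Max_in[OF fin ne] by (metis (no_types, lifting) imageE)
  have max: "depth f (c j) \<le> depth f (c i)" for j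
  proof -
    have "c j = c (j mod ?L)" by (simp add: c_def)
    moreover have "depth f (c (j mod ?L)) \<in> ?X" using u(3) by (intro imageI) simp
    ultimately show ?thesis unfolding i using fin by simp
  qed
  have c_shift: "c (i + ?L) = c i" by (simp add: c_def)
  have nxt: "f (c i) = c (Suc i)"
  proof (rule ccontr)
    assume "f (c i) \<noteq> c (Suc i)"
    then have "depth f (c (Suc i)) = Suc (depth f (c i))"
      using step[of i] depth_parent[OF f, of "c (Suc i)"] by auto
    then show False using max[of "Suc i"] by simp
  qed
  have Suc: "Suc (i + ?L - 1) = i + ?L" using u(3) by (cases p) auto
  have prev: "f (c i) = c (i + ?L - 1)"
  proof (rule ccontr)
    assume "f (c i) \<noteq> c (i + ?L - 1)"
    then have "depth f (c (i + ?L - 1)) = Suc (depth f (c i))"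
      using step[of "i + ?L - 1"] depth_parent[OF f, of "c (i + ?L - 1)"] unfolding Suc c_shift by auto
    then show False using max[of "i + ?L - 1"] by simp
  qed
  \<comment> \<open>The successor and the predecessor \<open>i + ?L - 1\<close> coincide, so
    \<open>?L\<close> divides their distance \<open>?L - 2\<close>, which is positive and smaller
    than \<open>?L\<close>.\<close>
  have "Suc i mod ?L = (i + ?L - 1) mod ?L" using nxt prev by (intro c_inj) simp
  moreover have "i + ?L - 1 = Suc i + (?L - 2)" using L by simp
  ultimately have "?L dvd ?L - 2"
    using mod_eq_dvd_iff_nat[of "Suc i" "i + ?L - 1" ?L] by simp
  then show False using L by (auto dest: dvd_imp_le)
qed

lemma tree_graph_in_graph_trees: "(tree_graph f, root_of f) \<in> graph_trees"
proof -
  have "card (children (tree_graph f, root_of f) i) = D i" if "i \<in> V" for i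
    using tree_graph_children[OF that] f that by (simp add: trees_def)
  moreover have "root_of f \<in> V" using root_of_iff by blast
  moreover have "\<not> length p \<ge> 3" if "pre_digraph.cycle (with_proj (tree_graph f)) p" for p
    using tree_graph_acyclic[OF that] by simp
  ultimately show ?thesis
    using tree_graph_pair_graph tree_graph_connected
    unfolding graph_trees_def rooted_tree_def undirected_tree_def by auto
qed

end

lemma tree_graph_inj: "inj_on (\<lambda>f. (tree_graph f, root_of f)) trees"
proof (rule inj_onI)
  fix f f' assume f: "f \<in> trees" "f' \<in> trees"
    and eq: "(tree_graph f, root_of f) = (tree_graph f', root_of f')"
  have ch: "f w = v \<longleftrightarrow> f' w = v" if "v \<in> V" "w \<in> V" for v w
    using tree_graph_children[OF f(1) that(1)] tree_graph_children[OF f(2) that(1)] eq that(2) by auto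
  show "f = f'"
  proof
    fix w
    show "f w = f' w"
    proof (cases "w \<in> V")
      case True
      then have "f w \<in> insert r V" "f' w \<in> insert r V" using f by (auto simp: trees_def)
      then show ?thesis using ch[of "f w" w] ch[of "f' w" w] True by (metis insert_iff)
    next
      case False
      then show ?thesis using f by (simp add: trees_def)
    qed
  qed
qed

lemma finite_graph_trees: "finite graph_trees"
  by (rule inj_on_finite[OF parent_inj _ finite_trees]) (auto intro: parent_in_trees)

text \<open>Injections in both directions between finite sets, which spares showing that the two
  constructions are inverse to each other.\<close>

lemma card_graph_trees: "card graph_trees = card trees"
proof (rule antisym)
  show "card graph_trees \<le> card trees"
    by (rule card_inj_on_le[OF parent_inj _ finite_trees]) (auto intro: parent_in_trees)
  show "card trees \<le> card graph_trees"
    by (rule card_inj_on_le[OF tree_graph_inj _ finite_graph_trees]) (auto intro: tree_graph_in_graph_trees)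
qed

section \<open>Transfer of the height bound and final estimate\<close>

theorem card_high_graph_trees:
  "card {t\<in>graph_trees. h \<le> tree_height t} \<le> card {f\<in>trees. \<exists>l\<in>V. D l = 0 \<and> (f ^^ h) l \<noteq> r}"
proof (rule card_inj_on_le)
  show "inj_on parent {t\<in>graph_trees. h \<le> tree_height t}"
    by (rule inj_on_subset[OF parent_inj]) auto
  show "parent ` {t\<in>graph_trees. h \<le> tree_height t} \<subseteq> {f\<in>trees. \<exists>l\<in>V. D l = 0 \<and> (f ^^ h) l \<noteq> r}"
  proof
    fix f assume "f \<in> parent ` {t\<in>graph_trees. h \<le> tree_height t}"
    then obtain G \<rho> where t: "(G, \<rho>) \<in> graph_trees" "h \<le> tree_height (G, \<rho>)" "f = parent (G, \<rho>)" by auto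
    show "f \<in> {f\<in>trees. \<exists>l\<in>V. D l = 0 \<and> (f ^^ h) l \<noteq> r}"
      using parent_in_trees[OF t(1)] tree_height_parent[OF t(1,2)] deep_leaf unfolding t(3) by blast
  qed
qed (use finite_trees in simp)

lemma tree_height_less:
  assumes "t \<in> graph_trees"
  shows "tree_height t < card V"
proof -
  obtain G \<rho> where t_eq: "t = (G, \<rho>)" by (cases t)
  note t = assms[unfolded t_eq]
  have V: "pverts G = V" and \<rho>: "\<rho> \<in> V" using graph_treeD(3,4)[OF t] by auto
  interpret pair_graph G by (rule graph_treeD(1)[OF t])
  have "graph_dist G \<rho> v < card V" if v: "v \<in> V" for v
  proof -
    obtain p where p: "apath \<rho> p v"
      using connected_apath[OF graph_treeD(1-3)[OF t], of v] v V by auto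
    then have "graph_dist G \<rho> v \<le> length p"
      unfolding graph_dist_def by (intro Least_le) (auto simp: apath_def)
    also have "\<dots> < card V" using length_apath_less[OF p] V by simp
    finally show ?thesis .
  qed
  then show ?thesis
    using finite_V \<rho> V unfolding t_eq tree_height_def by (simp, subst Max_less_iff) auto
qed

end

lemma tail_comparison:
  fixes z :: real
  assumes "z \<ge> 4000"
  shows "150000 * z * exp (- (z / 100)) < 5 * exp (- (2 * z / 2 ^ 12))"
proof -
  have e18: "exp (18::real) \<ge> 6600000"
  proof -
    have "(6600000::real) \<le> (5/4) ^ 72" by (simp add: power_divide)
    also have "\<dots> \<le> exp (1/4) ^ 72"
      using exp_ge_add_one_self[of "1/4::real"] by (intro power_mono) auto
    also have "\<dots> = exp (18::real)" by (simp flip: exp_of_nat_mult)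
    finally show ?thesis .
  qed
  \<comment> \<open>1/110 is below 1/100 - 2 / \<open>2 ^ 12\<close>, so \<open>exp v\<close> is
    still available. One half of it beats the constant, as \<open>v / 2 >= 18\<close>, the other
    half the linear factor.\<close>
  define v where "v = z / 110"
  have v: "v \<ge> 36" using assms by (simp add: v_def)
  have "6600000 * (v / 2) < exp (v / 2) * exp (v / 2)"
  proof (rule mult_le_less_imp_less)
    have "exp 18 \<le> exp (v / 2)" using v by simp
    then show "6600000 \<le> exp (v / 2)" using e18 by linarith
    show "v / 2 < exp (v / 2)" using exp_ge_add_one_self[of "v / 2"] by linarith
  qed (use v in auto)
  then have "30000 * z < exp v" by (simp add: v_def flip: exp_add)
  also have "\<dots> \<le> exp (z / 100 - 2 * z / 2 ^ 12)" using assms by (simp add: v_def)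
  finally have "5 * (30000 * z) * exp (- (z / 100)) < 5 * exp (z / 100 - 2 * z / 2 ^ 12) * exp (- (z / 100))"
    by simp
  also have "\<dots> = 5 * exp (- (2 * z / 2 ^ 12))" by (simp flip: exp_add)
  finally show ?thesis by simp
qed

theorem theorem6:
  fixes n :: nat and d :: "nat \<Rightarrow> nat" and \<delta> x :: real
  assumes "degree_sequence n d"
    and "\<delta> = (real n - real (degree_count n d 1)) / real n"
    and "x > 0"
  shows "measure_pmf.prob (pmf_of_set (labeled_trees n d))
           {t. real (tree_height t) \<ge> x * sqrt (real n)}
         < 5 * exp (- (\<delta> * x ^ 2 / 2 ^ 12))"
proof -
  \<comment> \<open>The label 0 is free and serves as the virtual parent, with the root as its only
    child.\<close>
  define D where "D v = (if v = 0 then 1 else d v)" for v :: nat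
  define V where "V = {1..n}"
  have V: "finite V" "0 \<notin> V" "card V = n" by (auto simp: V_def)
  have D: "D v = d v" if "v \<in> V" for v using that V(2) by (auto simp: D_def)
  have sum: "(\<Sum>v\<in>V. D v) + 1 = n"
  proof -
    have "(\<Sum>v\<in>V. D v) = (\<Sum>v\<in>V. d v)" by (intro sum.cong refl D)
    then show ?thesis using assms(1) by (simp add: degree_sequence_def V_def)
  qed
  interpret unique_root V 0 D
    by unfold_locales (use sum V in \<open>auto simp: D_def\<close>)
  have LT: "labeled_trees n d = graph_trees"
    unfolding labeled_trees_def graph_trees_def V_def[symmetric] using D by (auto cong: conj_cong)
  define M where "M = bigs V"
  let ?n1 = "degree_count n d 1"
  have count1: "?n1 = (\<Sum>v\<in>V. if D v = 1 then 1 else 0)"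
  proof -
    have "{j\<in>{1..n}. d j = 1} = {v\<in>V. D v = 1}" using D by (auto simp: V_def)
    then show ?thesis using V(1) by (simp add: degree_count_def sum.If_cases Int_def)
  qed
  have M: "M + ?n1 + 1 = n"
  proof -
    have "(\<Sum>v\<in>V. D v) = (\<Sum>v\<in>V. (if 2 \<le> D v then D v else 0) + (if D v = 1 then 1 else 0))"
      by (intro sum.cong) auto
    then show ?thesis using sum unfolding sum.distrib count1 M_def bigs_def by simp
  qed
  have leaves: "card {l\<in>V. D l = 0} \<le> M + 1"
  proof -
    have "card {l\<in>V. D l = 0} + ?n1 = card ({l\<in>V. D l = 0} \<union> {l\<in>V. D l = 1})"
      using V(1) unfolding count1 by (subst card_Un_disjoint) (auto simp: sum.If_cases Int_def)
    also have "\<dots> \<le> card V" using V(1) by (intro card_mono) auto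
    finally show ?thesis using M V(3) by simp
  qed
  have npos: "real n > 0" using M by simp
  define y where "y = \<delta> * x ^ 2"
  have y: "y = (M + 1) * x^2 / n" 
  proof -
    have "real n = real M + real ?n1 + 1" using M by linarith
    then have "real n - real ?n1 = real M + 1" by linarith
    then show ?thesis unfolding y_def assms(2) by simp
  qed
  let ?A = "{t. real (tree_height t) \<ge> x * sqrt (real n)}"
  let ?P = "measure_pmf.prob (pmf_of_set (labeled_trees n d)) ?A"
  have "?P < 5 * exp (- (y / 2 ^ 12))"
  \<comment> \<open>Below this threshold the bound exceeds 5 / e, which is more than 1.\<close>
  proof (cases "y < 2 ^ 12")
    case True
    have "?P \<le> 1" by simp
    also have "1 < 5 * exp (- 1 :: real)" using exp_le by (simp add: exp_minus field_simps)
    also have "\<dots> \<le> 5 * exp (- (y / 2 ^ 12))" using True by simp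
    finally show ?thesis .
  next
    case False
    define H where "H = nat \<lceil>x * sqrt (real n)\<rceil>"
    have ne: "trees \<noteq> {}" using trees_nonempty D_root by simp
    have cpos: "card trees > 0" using ne finite_trees by (simp add: card_gt_0_iff)
    have gne: "graph_trees \<noteq> {}" using cpos card_graph_trees by (metis card.empty less_irrefl)
    have P: "?P = card (graph_trees \<inter> ?A) / card trees"
      unfolding LT measure_pmf_of_set[OF gne finite_graph_trees] card_graph_trees ..
    show ?thesis
    \<comment> \<open>If no tree is that high the probability is 0; otherwise one such tree shows
      \<open>H < n\<close>, as \<open>height_tail\<close> requires.\<close>
    proof (cases "graph_trees \<inter> ?A = {}")
      case True
      then show ?thesis using P by simp
    next
      case nonempty: False
      then obtain t where t: "t \<in> graph_trees" "real (tree_height t) \<ge> x * sqrt (real n)" by auto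
      have "H \<le> tree_height t" using t(2) unfolding H_def by linarith
      then have Hn: "H < n" using tree_height_less[OF t(1)] V(3) by simp
      have xH: "x * sqrt (real n) \<le> H" unfolding H_def by linarith
      have x2: "x^2 * n \<le> (real H)^2"
      proof -
        have "(x * sqrt (real n))^2 \<le> (real H)^2" using xH assms(3) by (intro power_mono) auto
        then show ?thesis by (simp add: power_mult_distrib)
      qed
      define z where "z = real M * (real H)^2 / (real n)^2"
      have yle: "y \<le> (M + 1) * (real H)^2 / (real n)^2"
      proof -
        have "y = (M + 1) * (x^2 * n) / (real n)^2" using npos by (simp add: y power2_eq_square)
        also have "\<dots> \<le> (M + 1) * (real H)^2 / (real n)^2"
          using x2 by (intro divide_right_mono mult_left_mono) auto
        finally show ?thesis .
      qed
      \<comment> \<open>As \<open>y\<close> is at least \<open>2 ^ 12\<close>, this forces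
        \<open>M\<close> to be large, so that passing from \<open>M + 1\<close>, which is \<delta>
        n, to \<open>M\<close> costs little.\<close>
      have "(M + 1) * (real H)^2 / (real n)^2 < real (M + 1)"
      proof -
        have "(real H)^2 < (real n)^2" using Hn by (intro power_strict_mono) auto
        then have "(M + 1) * (real H)^2 < real (M + 1) * (real n)^2" by (intro mult_strict_left_mono) auto
        then show ?thesis using npos by (simp add: divide_less_eq)
      qed
      then have M4: "real M \<ge> 4096"
        using yle False by simp
      have yz: "y * M \<le> (M + 1) * z"
      proof -
        have "y * M \<le> (M + 1) * (real H)^2 / (real n)^2 * M" using yle by (intro mult_right_mono) auto
        then show ?thesis by (simp add: z_def mult.commute mult.left_commute)
      qed
      \<comment> \<open>\<open>z\<close> is at least \<open>y * M / (M + 1)\<close>; the margin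
        between 4096 and 4000 covers the quotient.\<close>
      have z1: "z \<ge> 4000"
      proof (rule ccontr)
        assume "\<not> z \<ge> 4000"
        then have "(M + 1) * z \<le> real (M + 1) * 4000" by (intro mult_left_mono) auto
        moreover have "4096 * real M \<le> y * M" using False by (intro mult_right_mono) auto
        ultimately have "4096 * real M \<le> real (M + 1) * 4000" using yz by linarith
        then show False using M4 by simp
      qed
      \<comment> \<open>The crude bound \<open>M + 1 <= 2 * M\<close> is the origin of the factor 2
        in \<open>tail_comparison\<close>.\<close>
      have z2: "y \<le> 2 * z"
      proof -
        have "y * M \<le> (M + 1) * z" by (rule yz)
        also have "\<dots> \<le> (2 * real M) * z" using M4 z1 by (intro mult_right_mono) auto
        finally have "y * real M \<le> (2 * z) * real M" by (simp add: ac_simps)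
        then show ?thesis using M4 by (intro mult_right_le_imp_le[of y "real M" "2 * z"]) auto
      qed
      have "real (card {f\<in>trees. \<exists>l\<in>V. D l = 0 \<and> (f ^^ H) l \<noteq> 0}) \<le>
          150000 * z * exp (- (z / 100)) * card trees"
      proof (rule height_tail)
        show "card {l\<in>V. D l = 0} \<le> 2 * bigs V" using leaves M4 by (simp add: M_def)
        show "z = real (bigs V) * (real H)^2 / (real (card V))^2" by (simp add: z_def M_def V(3))
      qed (use D_root Hn z1 V(3) in auto)
      moreover have "card (graph_trees \<inter> ?A) \<le> card {f\<in>trees. \<exists>l\<in>V. D l = 0 \<and> (f ^^ H) l \<noteq> 0}"
      proof -
        have "graph_trees \<inter> ?A \<subseteq> {t\<in>graph_trees. H \<le> tree_height t}"
          unfolding H_def by (auto simp: nat_le_iff ceiling_le_iff)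
        then have "card (graph_trees \<inter> ?A) \<le> card {t\<in>graph_trees. H \<le> tree_height t}"
          using finite_graph_trees by (intro card_mono) auto
        also note card_high_graph_trees
        finally show ?thesis .
      qed
      ultimately have "real (card (graph_trees \<inter> ?A)) \<le> 150000 * z * exp (- (z / 100)) * card trees" by linarith
      then have "?P \<le> 150000 * z * exp (- (z / 100))" using P cpos by (simp add: divide_le_eq)
      also have "\<dots> < 5 * exp (- (2 * z / 2 ^ 12))" by (rule tail_comparison[OF z1])
      also have "\<dots> \<le> 5 * exp (- (y / 2 ^ 12))" using z2 by simp
      finally show ?thesis .
    qed
  qed
  then show ?thesis by (simp add: y_def)
qed

end
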